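(* Let $\mathbb{S}^1=\mathbb{R}/\mathbb{Z}$ and let $f\in C^1(\mathbb{S}^1)$. Then the dynamical system $\dot{x}=f(x)$ on $\mathbb{S}^1$ is $C^1$ structurally stable if and only if it has finitely many fixed points (possibly none), all of which are hyperbolic.
   Context: $\mathbb{S}^1=\mathbb{R}/\mathbb{Z}$ is the circle, represented as the unit interval $[0,1]$ with end points identified. $C^1(\mathbb{S}^1)$ is the set of $C^1$ functions $f:\mathbb{S}^1\to\mathbb{R}$, equivalently continuously differentiable functions $f:\mathbb{R}\to\mathbb{R}$ with $f(x+1)=f(x)$ for all $x$. Each such $f$ is regarded as a vector field on $\mathbb{S}^1$, defining the dynamical system $\dot{x}=f(x)$ on $\mathbb{S}^1$. $C^1$-norm: $\|f\|_1:=\sup_{x\in\mathbb{S}^1}|f(x)|+\sup_{x\in\mathbb{S}^1}|f'(x)|$. For $\epsilon>0$, $B^1_\epsilon(f):=\{g\in C^1(\mathbb{S}^1):\|g-f\|_1<\epsilon\}$. A fixed point of $\dot{x}=f(x)$ is a point $x_*\in\mathbb{S}^1$ with $f(x_* )=0$. It is hyperbolic if $f'(x_* )\neq 0$. The orbit of a point $x_0\in\mathbb{S}^1$ is $\{x(t):t\in\mathbb{R}\}$, where $x(\cdot)$ is the solution with $x(0)=x_0$, oriented by increasing time. Two systems $\dot{x}=f(x)$ and $\dot{y}=g(y)$ on $\mathbb{S}^1$ are topologically equivalent if there is a homeomorphism $h:\mathbb{S}^1\to\mathbb{S}^1$ that maps oriented orbits of the first system onto oriented orbits of the second, i.e. it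 maps each orbit of the first onto an orbit of the second, preserving the orientation by increasing time. The system $\dot{x}=f(x)$ is $C^1$ structurally stable if for every sufficiently small $\epsilon>0$ and every $g\in B^1_\epsilon(f)$, the systems $\dot{x}=f(x)$ and $\dot{y}=g(y)$ are topologically equivalent (equivalently, there exists $\epsilon>0$ such that this holds for every $g\in B^1_\epsilon(f)$). *)

theory Defs
  imports "HOL-Analysis.Analysis"
begin

quotient_type circle = real / "\<lambda>x y :: real. x - y \<in> \<int>"
  morphisms rep_circle to_circle
proof (rule equivpI)
  show "reflp (\<lambda>x y :: real. x - y \<in> \<int>)"
    by (simp add: reflp_def)
  show "symp (\<lambda>x y :: real. x - y \<in> \<int>)"
    by (metis (mono_tags, lifting) Ints_minus minus_diff_eq sympI)
  show "transp (\<lambda>x y :: real. x - y \<in> \<int>)"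
    by (rule transpI) (metis Ints_add diff_add_cancel add_diff_eq)
qed

lemma to_circle_eq_iff: "to_circle x = to_circle y \<longleftrightarrow> x - y \<in> \<int>"
  by (rule circle.abs_eq_iff)

lemma to_circle_rep_circle [simp]: "to_circle (rep_circle p) = p"
  by (rule Quotient_abs_rep[OF Quotient_circle])

instantiation circle :: topological_space
begin

definition open_circle :: "circle set \<Rightarrow> bool"
  where "open_circle U \<longleftrightarrow> open (to_circle -` U)"

instance
  by standard (auto simp: open_circle_def vimage_Int vimage_Union)

end

text \<open>
  Calculus on the circle is done on the 1-periodic lift \<open>f \<circ> to_circle\<close>. The derivative does
  not depend on the representative chosen by \<open>rep_circle\<close>; see \<open>circle_deriv_to_circle\<close>.
\<close>

definition C1_circle :: "(circle \<Rightarrow> real) set"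
  where "C1_circle = {f. (f \<circ> to_circle) C1_differentiable_on UNIV}"

definition circle_deriv :: "(circle \<Rightarrow> real) \<Rightarrow> circle \<Rightarrow> real"
  where "circle_deriv f p = deriv (f \<circ> to_circle) (rep_circle p)"

lemma circle_deriv_to_circle: "circle_deriv f (to_circle x) = deriv (f \<circ> to_circle) x"
proof -
  define n where "n = rep_circle (to_circle x) - x"
  have n: "n \<in> \<int>"
    unfolding n_def using to_circle_eq_iff[of "rep_circle (to_circle x)" x] by simp
  have per: "(f \<circ> to_circle) \<circ> (+) n = f \<circ> to_circle"
    using n by (auto simp: fun_eq_iff intro!: arg_cong[where f = f] simp: to_circle_eq_iff)
  have "(f \<circ> to_circle has_field_derivative D) (at (n + x)) \<longleftrightarrow>
        (f \<circ> to_circle has_field_derivative D) (at x)" for D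
    using DERIV_at_within_shift[of "f \<circ> to_circle" D n x UNIV] per
    by (simp add: o_def)
  then have "deriv (f \<circ> to_circle) (n + x) = deriv (f \<circ> to_circle) x"
    unfolding deriv_def by simp
  then show ?thesis
    by (simp add: circle_deriv_def n_def)
qed

definition C1_norm :: "(circle \<Rightarrow> real) \<Rightarrow> real"
  where "C1_norm f = (SUP p. \<bar>f p\<bar>) + (SUP p. \<bar>circle_deriv f p\<bar>)"

definition C1_ball :: "(circle \<Rightarrow> real) \<Rightarrow> real \<Rightarrow> (circle \<Rightarrow> real) set"
  where "C1_ball f \<epsilon> = {g \<in> C1_circle. C1_norm (\<lambda>p. g p - f p) < \<epsilon>}"

definition fixed_points :: "(circle \<Rightarrow> real) \<Rightarrow> circle set"
  where "fixed_points f = {p. f p = 0}"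

definition hyperbolic :: "(circle \<Rightarrow> real) \<Rightarrow> circle \<Rightarrow> bool"
  where "hyperbolic f p \<longleftrightarrow> circle_deriv f p \<noteq> 0"

text \<open>
  A curve \<open>c\<close> on the circle solves the equation with right-hand side \<open>f\<close>, for all times, if it
  has a lift to the line that solves the lifted equation.
\<close>

definition solution :: "(circle \<Rightarrow> real) \<Rightarrow> (real \<Rightarrow> circle) \<Rightarrow> bool"
  where "solution f c \<longleftrightarrow>
    (\<exists>x. c = to_circle \<circ> x \<and> (\<forall>t. (x has_real_derivative f (to_circle (x t))) (at t)))"

definition orbit :: "(circle \<Rightarrow> real) \<Rightarrow> circle \<Rightarrow> circle set"
  where "orbit f p = {c t | c t. solution f c \<and> c 0 = p}"

text \<open>
  Orientation is preserved when \<open>h\<close> carries every solution of the first system to a solution of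
  the second one up to an increasing reparametrization \<open>\<tau>\<close> of time. The reparametrization may
  differ from one orbit to another.
\<close>

definition maps_oriented_orbits ::
    "(circle \<Rightarrow> circle) \<Rightarrow> (circle \<Rightarrow> real) \<Rightarrow> (circle \<Rightarrow> real) \<Rightarrow> bool"
  where "maps_oriented_orbits h f g \<longleftrightarrow>
    (\<forall>p. \<exists>q. h ` orbit f p = orbit g q) \<and>
    (\<forall>c. solution f c \<longrightarrow>
      (\<exists>d \<tau>. solution g d \<and> strict_mono \<tau> \<and> surj \<tau> \<and> continuous_on UNIV \<tau> \<and> h \<circ> c = d \<circ> \<tau>))"

definition topologically_equivalent :: "(circle \<Rightarrow> real) \<Rightarrow> (circle \<Rightarrow> real) \<Rightarrow> bool"
  where "topologically_equivalent f g \<longleftrightarrow>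
    (\<exists>h k. homeomorphism UNIV UNIV h k \<and> maps_oriented_orbits h f g)"

definition C1_structurally_stable :: "(circle \<Rightarrow> real) \<Rightarrow> bool"
  where "C1_structurally_stable f \<longleftrightarrow>
    (\<forall>\<^sub>F \<epsilon> in at_right 0. \<forall>g \<in> C1_ball f \<epsilon>. topologically_equivalent f g)"

end

theory Submission
  imports Defs
begin

text \<open>
  If all zeros of \<open>f\<close> are simple, a \<open>C\<^sup>1\<close>-close \<open>g\<close> has exactly one zero near each zero of \<open>f\<close>
  and the sign of \<open>f\<close> elsewhere. A homeomorphism of the line that commutes with \<open>x \<mapsto> x + 1\<close>
  and shifts each zero of \<open>f\<close> to the corresponding zero of \<open>g\<close> by means of a small tent function
  then preserves signs, and this suffices for equivalence, because an orbit through a nonzero of the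
  field sweeps out the whole component of the set of nonzeros.

  Conversely, an equivalence induces a bijection of the fixed points. By Sard's theorem
  \<open>f - c\<close> has only simple, hence finitely many, zeros for arbitrarily small \<open>c\<close>, so a stable \<open>f\<close> has
  finitely many fixed points. If one of them were not hyperbolic, multiplying \<open>f\<close> by a cut-off
  function would be a \<open>C\<^sup>1\<close>-small perturbation vanishing on an arc, with infinitely many fixed
  points.
\<close>

text \<open>Solutions are required to exist for all times, so global existence is proved by hand: a
  solution is the inverse of its time map, and a Lipschitz bound makes that map diverge at the zeros
  of the field. A time change between two orbits is then the inverse of one solution composed with
  the image of the other; it is increasing and onto, and this already makes it continuous. Sums of
  periodic tents treat all zeros alike, whatever their cyclic order, and cover the case of no zeros.
  Topological equivalence does not preserve hyperbolicity, so the converse can only compare finite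
  with infinite sets of fixed points; both perturbations are therefore taken from the same ball. The
  cut-off relies on degeneracy: on an arc of length of order d its slope is of order 1/d, while the
  field is o(d) there, so their product, which enters the derivative, stays small.\<close>

section \<open>Periodic scalar differential equations\<close>

definition solves :: "(real \<Rightarrow> real) \<Rightarrow> (real \<Rightarrow> real) \<Rightarrow> bool"
  where "solves F x \<longleftrightarrow> (\<forall>t. (x has_real_derivative F (x t)) (at t))"

lemma solves_shift: "solves F (\<lambda>t. x (t + s))" if "solves F x"
  using that by (simp add: solves_def flip: DERIV_shift)

lemma solves_reverse: "solves (\<lambda>u. - F u) (\<lambda>t. x (- t))" if "solves F x"
  using that unfolding solves_def DERIV_mirror[symmetric] by simp

text \<open>Reversing time and space together keeps the sign of the field, so claims about points
  below the start follow from claims about points above it.\<close>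

lemma solves_reflect: "solves (\<lambda>u. F (- u)) (\<lambda>t. - x (- t))" if "solves F x"
proof -
  have "((\<lambda>t. x (- t)) has_real_derivative - F (x (- t))) (at t)" for t
    using solves_reverse[OF that] by (simp add: solves_def)
  then show ?thesis
    unfolding solves_def by (auto intro!: derivative_eq_intros)
qed

lemma solves_const: "F a = 0 \<Longrightarrow> solves F (\<lambda>t. a)"
  by (simp add: solves_def)

lemma solves_continuous: "continuous_on S x" if "solves F x"
  using that unfolding solves_def
  by (meson DERIV_isCont continuous_at_imp_continuous_on)

section \<open>Periodic functions on the line\<close>

lemma periodic_Ints:
  fixes \<phi> :: "real \<Rightarrow> 'a"
  assumes "\<And>x. \<phi> (x + 1) = \<phi> x" "n \<in> \<int>"
  shows "\<phi> (x + n) = \<phi> x"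
proof -
  have nat: "\<phi> (y + real k) = \<phi> y" for y k
  proof (induction k)
    case (Suc k)
    then show ?case using assms(1)[of "y + real k"] by (simp add: algebra_simps)
  qed simp
  obtain k where k: "n = of_int k" using assms(2) by (auto elim: Ints_cases)
  show ?thesis
  proof (cases "k \<ge> 0")
    case True
    then show ?thesis using nat[of x "nat k"] k by simp
  next
    case False
    then show ?thesis using nat[of "x + n" "nat (- k)"] k by simp
  qed
qed

lemma periodic_frac:
  fixes \<phi> :: "real \<Rightarrow> 'a"
  assumes "\<And>x. \<phi> (x + 1) = \<phi> x"
  shows "\<phi> (frac x) = \<phi> x"
  using periodic_Ints[of \<phi> "- of_int \<lfloor>x\<rfloor>" x, OF assms] by (simp add: frac_def)

lemma periodic_bounded:
  fixes \<phi> :: "real \<Rightarrow> real"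
  assumes "\<And>x. \<phi> (x + 1) = \<phi> x" "continuous_on UNIV \<phi>"
  obtains B where "B > 0" "\<And>x. \<bar>\<phi> x\<bar> \<le> B"
proof -
  have "compact (\<phi> ` {0..1})"
    using assms(2) by (intro compact_continuous_image continuous_on_subset[OF assms(2)]) auto
  then obtain B where B: "B > 0" "\<And>x. x \<in> {0..1} \<Longrightarrow> \<bar>\<phi> x\<bar> \<le> B"
    using bounded_pos[of "\<phi> ` {0..1}"] compact_imp_bounded by auto
  have "\<bar>\<phi> x\<bar> \<le> B" for x
    using B(2)[of "frac x"] periodic_frac[of \<phi> x, OF assms(1)] frac_lt_1[of x]
    by (simp add: less_imp_le)
  then show ?thesis using B that by blast
qed

text \<open>The lift of a C1 field on the circle. The derivative is a parameter so that
  \<open>- F\<close> and \<open>F (- x)\<close> become instances without computing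
  \<open>deriv\<close>.\<close>

locale periodic_C1 =
  fixes F F' :: "real \<Rightarrow> real"
  assumes periodic: "F (x + 1) = F x"
    and DERIV: "(F has_real_derivative F' x) (at x)"
    and continuous_deriv: "continuous_on UNIV F'"
begin

lemma continuous: "continuous_on S F"
  using DERIV by (meson DERIV_isCont continuous_at_imp_continuous_on)

lemma periodic_deriv: "F' (x + 1) = F' x"
proof -
  have "((\<lambda>y. F (y + 1)) has_real_derivative F' (x + 1)) (at x)"
    using DERIV[of "x + 1"] by (simp add: DERIV_shift)
  then show ?thesis
    using DERIV[of x] DERIV_unique by (simp add: periodic)
qed

lemma periodic_C1_minus: "periodic_C1 (\<lambda>x. - F x) (\<lambda>x. - F' x)"
  by standard (auto simp: periodic intro!: derivative_eq_intros DERIV continuous_intros continuous_deriv)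

lemma periodic_C1_reflect: "periodic_C1 (\<lambda>x. F (- x)) (\<lambda>x. - F' (- x))"
proof
  show "F (- (x + 1)) = F (- x)" for x
    using periodic[of "- x - 1"] by simp
  show "((\<lambda>x. F (- x)) has_real_derivative - F' (- x)) (at x)" for x
    using DERIV[of "- x"] by (simp flip: DERIV_mirror)
  show "continuous_on UNIV (\<lambda>x. - F' (- x))"
    by (intro continuous_intros continuous_on_compose2[OF continuous_deriv]) auto
qed

lemma Lipschitz:
  obtains L where "L > 0" "\<And>x y. \<bar>F x - F y\<bar> \<le> L * \<bar>x - y\<bar>"
proof -
  obtain L where L: "L > 0" "\<And>x. \<bar>F' x\<bar> \<le> L"
    using periodic_bounded[of F', OF periodic_deriv continuous_deriv] by blast
  have "\<bar>F x - F y\<bar> \<le> L * \<bar>x - y\<bar>" for x y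
    using field_differentiable_bound[of UNIV F F' L x y] DERIV L(2) by simp
  then show ?thesis using L that by blast
qed

text \<open>Gronwall's argument: \<open>(x \<tau> - x s)\<^sup>2 * exp (- 2 * L * \<tau>)\<close> is nonincreasing.\<close>

lemma solves_zero_forward:
  assumes "solves F x" "F (x s) = 0" "s \<le> t"
  shows "x t = x s"
proof -
  obtain L where L: "L > 0" "\<And>u v. \<bar>F u - F v\<bar> \<le> L * \<bar>u - v\<bar>" using Lipschitz by blast
  let ?a = "x s"
  define v where "v \<tau> = (x \<tau> - ?a)\<^sup>2 * exp (- 2 * L * \<tau>)" for \<tau>
  have "v t \<le> v s"
  proof (rule DERIV_nonpos_imp_nonincreasing[OF assms(3)])
    fix \<tau>
    let ?y = "x \<tau> - ?a"
    have x: "(x has_real_derivative F (x \<tau>)) (at \<tau>)" using assms(1) by (simp add: solves_def)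
    have v': "(v has_real_derivative 2 * (?y * F (x \<tau>) - L * ?y\<^sup>2) * exp (- 2 * L * \<tau>)) (at \<tau>)"
      unfolding v_def
      by (rule derivative_eq_intros refl x | simp)+ (simp add: algebra_simps power2_eq_square)
    have "?y * F (x \<tau>) \<le> L * ?y\<^sup>2"
    proof -
      have "?y * F (x \<tau>) \<le> \<bar>?y\<bar> * \<bar>F (x \<tau>)\<bar>" by (metis abs_ge_self abs_mult)
      also have "\<dots> \<le> \<bar>?y\<bar> * (L * \<bar>?y\<bar>)"
        using L(2)[of "x \<tau>" ?a] assms(2) by (intro mult_left_mono) auto
      finally show ?thesis by (simp add: power2_eq_square mult.left_commute[of L])
    qed
    then have "2 * (?y * F (x \<tau>) - L * ?y\<^sup>2) * exp (- 2 * L * \<tau>) \<le> 0"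
      by (simp add: mult_le_0_iff)
    then show "\<exists>y. (v has_real_derivative y) (at \<tau>) \<and> y \<le> 0" using v' by blast
  qed
  then have "(x t - ?a)\<^sup>2 * exp (- 2 * L * t) \<le> 0" by (simp add: v_def)
  then show ?thesis by (simp add: mult_le_0_iff)
qed

lemma solves_zero:
  assumes "solves F x" "F (x s) = 0"
  shows "x t = x s"
proof (cases "s \<le> t")
  case True
  then show ?thesis using solves_zero_forward assms by blast
next
  case False
  \<comment> \<open>Reversing time turns \<open>t < s\<close> into the forward case for
    \<open>- F\<close>.\<close>
  interpret R: periodic_C1 "\<lambda>x. - F x" "\<lambda>x. - F' x" by (rule periodic_C1_minus)
  show ?thesis
    using R.solves_zero_forward[OF solves_reverse[OF assms(1)], of "- s" "- t"] assms(2) False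
    by simp
qed

text \<open>A change of sign along the solution would pass through a zero, and there
  \<open>solves_zero\<close> makes the solution constant.\<close>

lemma solves_pos:
  assumes "solves F x" "F (x s) > 0"
  shows "F (x t) > 0"
proof (rule ccontr)
  assume "\<not> F (x t) > 0"
  moreover have "connected ((\<lambda>t. F (x t)) ` UNIV)"
    by (intro connected_continuous_image continuous_on_compose2[OF continuous[of UNIV]]
        solves_continuous[OF assms(1)]) auto
  ultimately have "0 \<in> range (\<lambda>t. F (x t))"
    using assms(2) by (intro connectedD_interval[of "range (\<lambda>t. F (x t))" "F (x t)" "F (x s)" 0]) auto
  then obtain r where "F (x r) = 0" by auto
  then show False
    using solves_zero[OF assms(1), of r s] assms(2) by simp
qed

lemma solves_strict_mono:
  assumes "solves F x" "F (x s) > 0"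
  shows "strict_mono x"
proof (rule strict_monoI)
  fix a b :: real assume "a < b"
  then show "x a < x b"
  proof (rule DERIV_pos_imp_increasing)
    fix t
    show "\<exists>y. (x has_real_derivative y) (at t) \<and> 0 < y"
      using assms(1) solves_pos[OF assms, of t] by (auto simp: solves_def)
  qed
qed

text \<open>A solution that stayed below \<open>z\<close> would remain in a compact interval where
  the speed has a positive minimum \<open>F m\<close>, and so would rise at least linearly.\<close>

lemma solves_reaches_above:
  assumes x: "solves F x" and "x 0 \<le> z" and pos: "\<And>u. u \<in> {x 0..z} \<Longrightarrow> F u > 0"
  shows "z \<in> range x"
proof (rule ccontr)
  assume z: "z \<notin> range x"
  have p0: "F (x 0) > 0" using assms(2) pos by auto
  have conn: "connected (range x)"
    by (intro connected_continuous_image solves_continuous[OF x]) auto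
  have below: "x t < z" for t
    using connectedD_interval[OF conn, of "x 0" "x t" z] z assms(2) by (meson not_le rangeI)
  obtain m where m: "m \<in> {x 0..z}" "\<And>u. u \<in> {x 0..z} \<Longrightarrow> F m \<le> F u"
    using continuous_attains_inf[of "{x 0..z}" F] continuous assms(2) by auto
  have Fm: "F m > 0" using pos m(1) by blast
  \<comment> \<open>The time by which the minimal speed \<open>F m\<close> alone would carry the
    solution to \<open>z\<close>.\<close>
  define t where "t = (z - x 0) / F m"
  have t: "t \<ge> 0" using Fm assms(2) by (simp add: t_def)
  have "x 0 - F m * 0 \<le> x t - F m * t"
  proof (rule DERIV_nonneg_imp_nondecreasing[OF t])
    fix \<tau> :: real assume "0 \<le> \<tau>"
    then have "x \<tau> \<in> {x 0..z}"
      using strict_mono_less_eq[OF solves_strict_mono[OF x p0]] below[of \<tau>] by auto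
    then show "\<exists>y. ((\<lambda>\<tau>. x \<tau> - F m * \<tau>) has_real_derivative y) (at \<tau>) \<and> 0 \<le> y"
      using x m(2) unfolding solves_def
      by (intro exI[of _ "F (x \<tau>) - F m"]) (auto intro!: derivative_eq_intros)
  qed
  moreover have "F m * t = z - x 0" using Fm by (simp add: t_def)
  ultimately show False using below[of t] by simp
qed

text \<open>The right-hand side is the component of \<open>x 0\<close> in the set where
  \<open>F\<close> is positive, described by segments because increasing maps carry segments to
  segments. One inclusion holds since the range is convex, the other by
  \<open>solves_reaches_above\<close> and its reflection.\<close>

lemma range_solution:
  assumes x: "solves F x" and pos: "F (x 0) > 0"
  shows "range x = {z. \<forall>u \<in> closed_segment (x 0) z. F u > 0}" (is "_ = ?C")
proof (intro subset_antisym subsetI)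
  fix z assume "z \<in> range x"
  then obtain t where z: "z = x t" by auto
  have "convex (range x)"
    by (intro connected_convex_1[THEN iffD1] connected_continuous_image solves_continuous[OF x]) auto
  then have "closed_segment (x 0) z \<subseteq> range x"
    using z by (intro closed_segment_subset) auto
  then show "z \<in> ?C" using solves_pos[OF x pos] by auto
next
  fix z assume z: "z \<in> ?C"
  show "z \<in> range x"
  proof (cases "x 0 \<le> z")
    case True
    then show ?thesis
      using z by (intro solves_reaches_above[OF x]) (auto simp: closed_segment_eq_real_ivl)
  next
    case False
    interpret R: periodic_C1 "\<lambda>x. F (- x)" "\<lambda>x. - F' (- x)" by (rule periodic_C1_reflect)
    have "- z \<in> range (\<lambda>t. - x (- t))"
      using z False
      by (intro R.solves_reaches_above[OF solves_reflect[OF x]])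
        (auto simp: closed_segment_eq_real_ivl)
    then show ?thesis by auto
  qed
qed

text \<open>A solution is the inverse of its time map, whose derivative is \<open>1 / F\<close>.\<close>

lemma solution_from_time_map:
  assumes "open I" "convex I" "a \<in> I" and pos: "\<And>z. z \<in> I \<Longrightarrow> F z > 0"
    and T: "\<And>z. z \<in> I \<Longrightarrow> (T has_real_derivative inverse (F z)) (at z)"
    and above: "\<And>s. \<exists>z \<in> I. T z \<ge> s" and below: "\<And>s. \<exists>z \<in> I. T z \<le> s"
  shows "\<exists>x. solves F x \<and> x 0 = a"
proof -
  have mono: "T u < T v" if "u \<in> I" "v \<in> I" "u < v" for u v
  proof (rule DERIV_pos_imp_increasing[OF that(3)])
    fix w assume "u \<le> w" "w \<le> v"
    then have "w \<in> I"
      using closed_segment_subset[OF that(1,2) assms(2)] that(3)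
      by (auto simp: closed_segment_eq_real_ivl)
    then show "\<exists>y. (T has_real_derivative y) (at w) \<and> 0 < y" using T pos by fastforce
  qed
  then have inj: "inj_on T I" by (metis linorder_inj_onI' less_irrefl)
  have "continuous_on I T"
    using T by (meson DERIV_isCont continuous_at_imp_continuous_on)
  then have "connected (T ` I)"
    using assms(2) convex_connected connected_continuous_image by blast
  then have surj: "T ` I = UNIV"
    using above below connectedD_interval[of "T ` I"] by (metis UNIV_eq_I imageI)
  define X where "X = inv_into I T"
  have XI: "X t \<in> I" and TX: "T (X t) = t" for t
    unfolding X_def using surj by (auto intro: inv_into_into f_inv_into_f)
  have XT: "X (T z) = z" if "z \<in> I" for z
    unfolding X_def using inj that by simp
  have "range X = I" using XI XT by (metis UNIV_I image_subsetI rangeI subsetI subset_antisym)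
  moreover have "X u \<le> X v" if "u \<le> v" for u v
    using mono[OF XI XI, of v u] TX that by (metis not_le)
  \<comment> \<open>A monotone function whose range is open is continuous.\<close>
  ultimately have cont: "continuous_on UNIV X"
    using assms(1) by (intro continuous_onI_mono) auto
  have "(X has_real_derivative F (X t)) (at t)" for t
  proof -
    have "(X has_real_derivative inverse (inverse (F (X t)))) (at t)"
    proof (rule DERIV_inverse_function[where f = T and a = "t - 1" and b = "t + 1"])
      show "isCont X t" using cont continuous_on_eq_continuous_at open_UNIV by blast
      show "inverse (F (X t)) \<noteq> 0" using pos[OF XI, of t] by auto
    qed (use T XI TX in auto)
    then show ?thesis by simp
  qed
  \<comment> \<open>The shift by \<open>T a\<close> makes the solution start at \<open>a\<close>,
    since \<open>X (T a) = a\<close>.\<close>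
  then have "solves F (\<lambda>t. X (t + T a))" by (intro solves_shift) (simp add: solves_def)
  then show ?thesis using XT[OF assms(3)] by (intro exI[of _ "\<lambda>t. X (t + T a)"]) auto
qed

text \<open>The time map has to be unbounded in both directions. If \<open>F\<close> has no zero,
  its derivative is at least \<open>1 / B\<close>. Otherwise \<open>a\<close> lies between
  neighbouring zeros \<open>c < b\<close>, and the time map diverges logarithmically at
  both.\<close>

lemma ex_solution_pos:
  assumes "F a > 0"
  shows "\<exists>x. solves F x \<and> x 0 = a"
proof (cases "\<exists>z. F z = 0")
  case False
  have pos: "F z > 0" for z
  proof (rule ccontr)
    assume "\<not> F z > 0"
    then have "0 \<in> range F"
      using connectedD_interval[OF connected_continuous_image[OF continuous connected_UNIV], of "F z" "F a" 0]
        assms by auto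
    then show False using False by auto
  qed
  obtain B where B: "B > 0" "\<And>z. \<bar>F z\<bar> \<le> B"
    using periodic_bounded[of F, OF periodic continuous] by blast
  have "isCont F z" for z using DERIV DERIV_isCont by blast
  then have "\<exists>T. \<forall>z. -\<infinity> < ereal z \<longrightarrow> ereal z < \<infinity> \<longrightarrow>
      (T has_vector_derivative inverse (F z)) (at z)"
    using pos by (intro einterval_antiderivative continuous_at_within_inverse) (auto simp: less_le)
  then obtain T where T: "\<And>z. (T has_real_derivative inverse (F z)) (at z)"
    by (auto simp: has_real_derivative_iff_has_vector_derivative)
  have grow: "T u - u / B \<le> T v - v / B" if "u \<le> v" for u v
  proof (rule DERIV_nonneg_imp_nondecreasing[OF that])
    fix z
    have "inverse B \<le> inverse (F z)"
      using B(2)[of z] pos[of z] by (intro le_imp_inverse_le) auto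
    then show "\<exists>y. ((\<lambda>u. T u - u / B) has_real_derivative y) (at z) \<and> 0 \<le> y"
      using T[of z] B(1) by (intro exI[of _ "inverse (F z) - inverse B"])
        (auto intro!: derivative_eq_intros simp: inverse_eq_divide)
  qed
  show ?thesis
  proof (rule solution_from_time_map[where I = UNIV and T = T])
    fix s
    define z where "z = B * \<bar>s - T 0\<bar>"
    have "z / B = \<bar>s - T 0\<bar>" "z \<ge> 0" using B(1) by (auto simp: z_def)
    then have "T z \<ge> s" "T (- z) \<le> s"
      using grow[of 0 z] grow[of "- z" 0] by auto
    then show "\<exists>z \<in> UNIV. T z \<ge> s" "\<exists>z \<in> UNIV. T z \<le> s" by blast+
  qed (use pos T in auto)
next
  case True
  then obtain z0 where z0: "F z0 = 0" by blast
  define Z where "Z = {z. F z = 0}"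
  have closed: "closed Z"
    unfolding Z_def using continuous_closed_preimage_constant[OF continuous[of UNIV]] by simp
  have zn: "F (z0 + of_int n) = 0" for n
    using periodic_Ints[of F "of_int n" z0] periodic z0 by simp
  \<comment> \<open>The nearest zero to the right: the translates of \<open>z0\<close> supply one,
    and closedness of \<open>Z\<close> gives a least one.\<close>
  have "\<exists>b \<in> Z. b > a \<and> (\<forall>z. a \<le> z \<and> z < b \<longrightarrow> z \<notin> Z)"
  proof -
    let ?S = "Z \<inter> {a..}"
    have "z0 + of_int \<lceil>a - z0\<rceil> \<in> ?S" using zn by (simp add: Z_def) linarith
    then have ne: "?S \<noteq> {}" by blast
    have bb: "bdd_below ?S" by (intro bdd_belowI[of _ a]) auto
    have "Inf ?S \<in> ?S" using closed ne bb by (intro closed_contains_Inf) auto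
    moreover have "z \<notin> Z" if "a \<le> z" "z < Inf ?S" for z
      using cInf_lower[OF _ bb, of z] that by auto
    ultimately show ?thesis
      using assms by (intro bexI[of _ "Inf ?S"]) (auto simp: Z_def order.order_iff_strict)
  qed
  then obtain b where b: "F b = 0" "b > a" "\<And>z. a \<le> z \<Longrightarrow> z < b \<Longrightarrow> F z \<noteq> 0"
    unfolding Z_def by blast
  have "\<exists>b \<in> Z. b < a \<and> (\<forall>z. b < z \<and> z \<le> a \<longrightarrow> z \<notin> Z)"
  proof -
    let ?S = "Z \<inter> {..a}"
    have "z0 + of_int \<lfloor>a - z0\<rfloor> \<in> ?S" using zn by (simp add: Z_def) linarith
    then have ne: "?S \<noteq> {}" by blast
    have bb: "bdd_above ?S" by (intro bdd_aboveI[of _ a]) auto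
    have "Sup ?S \<in> ?S" using closed ne bb by (intro closed_contains_Sup) auto
    moreover have "z \<notin> Z" if "z \<le> a" "Sup ?S < z" for z
      using cSup_upper[OF _ bb, of z] that by auto
    ultimately show ?thesis
      using assms by (intro bexI[of _ "Sup ?S"]) (auto simp: Z_def order.order_iff_strict)
  qed
  then obtain c where c: "F c = 0" "c < a" "\<And>z. c < z \<Longrightarrow> z \<le> a \<Longrightarrow> F z \<noteq> 0"
    unfolding Z_def by blast
  have pos: "F z > 0" if z: "z \<in> {c<..<b}" for z
  proof (rule ccontr)
    assume "\<not> F z > 0"
    moreover have "connected (F ` {c<..<b})"
      by (intro connected_continuous_image continuous) auto
    ultimately have "0 \<in> F ` {c<..<b}"
      using connectedD_interval[of "F ` {c<..<b}" "F z" "F a" 0] z assms b(2) c(2) by auto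
    then show False using b(3) c(3) by (auto) (metis linear)
  qed
  have "isCont F z" for z using DERIV DERIV_isCont by blast
  then have "\<exists>T. \<forall>z. ereal c < ereal z \<longrightarrow> ereal z < ereal b \<longrightarrow>
      (T has_vector_derivative inverse (F z)) (at z)"
    using pos b(2) c(2)
    by (intro einterval_antiderivative continuous_at_within_inverse) (use pos in \<open>force+\<close>)
  then obtain T where T: "\<And>z. z \<in> {c<..<b} \<Longrightarrow> (T has_real_derivative inverse (F z)) (at z)"
    by (auto simp: has_real_derivative_iff_has_vector_derivative)
  obtain L where L: "L > 0" "\<And>u v. \<bar>F u - F v\<bar> \<le> L * \<bar>u - v\<bar>" using Lipschitz by blast
  \<comment> \<open>Since \<open>F b = 0\<close>, the Lipschitz bound gives
    \<open>F z \<le> L * (b - z)\<close>, so \<open>T\<close> grows at least as fast as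
    \<open>- ln (b - v) / L\<close>, which is unbounded near \<open>b\<close>.\<close>
  have up: "T a + ln (b - a) / L \<le> T v + ln (b - v) / L" if v: "a \<le> v" "v < b" for v
  proof (rule DERIV_nonneg_imp_nondecreasing[OF v(1)])
    fix z assume "a \<le> z" "z \<le> v"
    then have z: "z \<in> {c<..<b}" using v c(2) by auto
    have "inverse (L * (b - z)) \<le> inverse (F z)"
      using L(2)[of z b] b(1) pos[OF z] z by (intro le_imp_inverse_le) auto
    moreover have "((\<lambda>u. T u + ln (b - u) / L) has_real_derivative
        inverse (F z) - inverse (L * (b - z))) (at z)"
      using z L(1) by (auto intro!: derivative_eq_intros T simp: divide_inverse mult.commute)
    ultimately show "\<exists>y. ((\<lambda>u. T u + ln (b - u) / L) has_real_derivative y) (at z) \<and> 0 \<le> y"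
      by (metis diff_ge_0_iff_ge)
  qed
  have down: "T v - ln (v - c) / L \<le> T a - ln (a - c) / L" if v: "c < v" "v \<le> a" for v
  proof (rule DERIV_nonneg_imp_nondecreasing[OF v(2)])
    fix z assume "v \<le> z" "z \<le> a"
    then have z: "z \<in> {c<..<b}" using v b(2) by auto
    have "inverse (L * (z - c)) \<le> inverse (F z)"
      using L(2)[of z c] c(1) pos[OF z] z by (intro le_imp_inverse_le) auto
    moreover have "((\<lambda>u. T u - ln (u - c) / L) has_real_derivative
        inverse (F z) - inverse (L * (z - c))) (at z)"
      using z L(1) by (auto intro!: derivative_eq_intros T simp: divide_inverse mult.commute)
    ultimately show "\<exists>y. ((\<lambda>u. T u - ln (u - c) / L) has_real_derivative y) (at z) \<and> 0 \<le> y"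
      by (metis diff_ge_0_iff_ge)
  qed
  show ?thesis
  proof (rule solution_from_time_map[where I = "{c<..<b}" and T = T])
    fix s
    let ?e = "exp (- L * \<bar>s - T a\<bar>)"
    have e: "0 < ?e" "?e \<le> 1" using L(1) by auto
    \<comment> \<open>Chosen so that
      \<open>ln (b - u) = ln (b - a) - L * \<bar>s - T a\<bar>\<close>; then \<open>up\<close>
      yields \<open>T u \<ge> T a + \<bar>s - T a\<bar> \<ge> s\<close>. The point \<open>w\<close>
      below plays the same part at \<open>c\<close>.\<close>
    define u where "u = b - (b - a) * ?e"
    have "b - u \<le> b - a" "b - u > 0"
      unfolding u_def using e b(2) mult_left_le[of ?e "b - a"] by auto
    moreover have "ln (b - u) = ln (b - a) - L * \<bar>s - T a\<bar>"
      unfolding u_def using b(2) by (simp add: ln_mult)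
    ultimately have "s \<le> T u" "u \<in> {c<..<b}"
      using up[of u] L(1) c(2) by (auto simp: diff_divide_distrib)
    then show "\<exists>z \<in> {c<..<b}. T z \<ge> s" by blast
    define w where "w = c + (a - c) * ?e"
    have "w - c \<le> a - c" "w - c > 0"
      unfolding w_def using e c(2) mult_left_le[of ?e "a - c"] by auto
    moreover have "ln (w - c) = ln (a - c) - L * \<bar>s - T a\<bar>"
      unfolding w_def using c(2) by (simp add: ln_mult)
    ultimately have "s \<ge> T w" "w \<in> {c<..<b}"
      using down[of w] L(1) b(2) by (auto simp: diff_divide_distrib)
    then show "\<exists>z \<in> {c<..<b}. T z \<le> s" by blast
  qed (use pos T b(2) c(2) in auto)
qed

lemma ex_solution: "\<exists>x. solves F x \<and> x 0 = a"
proof -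
  consider "F a > 0" | "F a = 0" | "- F a > 0" by linarith
  then show ?thesis
  proof cases
    case 1
    then show ?thesis by (rule ex_solution_pos)
  next
    case 2
    then show ?thesis using solves_const by blast
  next
    case 3
    interpret R: periodic_C1 "\<lambda>x. - F x" "\<lambda>x. - F' x" by (rule periodic_C1_minus)
    obtain x where "solves (\<lambda>x. - F x) x" "x 0 = a" using R.ex_solution_pos[OF 3] by blast
    then show ?thesis using solves_reverse[of "\<lambda>x. - F x" x] by (intro exI[of _ "\<lambda>t. x (- t)"]) auto
  qed
qed

end

section \<open>Reparametrization along sign-preserving homeomorphisms\<close>

text \<open>The lifts of orientation-preserving homeomorphisms of the circle. Continuity is
  automatic for an increasing surjection, see \<open>strict_mono_surj_continuous\<close>.\<close>

definition lifted_homeo :: "(real \<Rightarrow> real) \<Rightarrow> bool"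
  where "lifted_homeo H \<longleftrightarrow> strict_mono H \<and> surj H \<and> (\<forall>x. H (x + 1) = H x + 1)"

lemma strict_mono_surj_continuous:
  fixes H :: "real \<Rightarrow> real"
  assumes "strict_mono H" "surj H"
  shows "continuous_on UNIV H"
  using assms by (intro continuous_onI_mono) (auto dest: strict_mono_mono monoD)

lemma lifted_homeo_inv:
  assumes "lifted_homeo H"
  shows "lifted_homeo (inv H)"
proof -
  have H: "strict_mono H" "surj H" "\<And>x. H (x + 1) = H x + 1"
    using assms by (auto simp: lifted_homeo_def)
  have inj: "inj H" using H(1) strict_mono_imp_inj_on by blast
  have "inv H (y + 1) = inv H y + 1" for y
    using H(2,3) inj by (intro inv_f_eq) (simp_all add: surj_f_inv_f)
  moreover have "strict_mono (inv H)"
    using H(1,2) by (intro strict_monoI) (metis strict_mono_less surj_f_inv_f)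
  moreover have "surj (inv H)" using inj by (rule inj_imp_surj_inv)
  ultimately show ?thesis by (simp add: lifted_homeo_def)
qed

text \<open>\<open>H\<close> carries the component swept out by \<open>x\<close> onto the one swept
  out by the solution \<open>y\<close> through \<open>H (x 0)\<close>. As \<open>y\<close> is
  injective, \<open>\<tau>\<close> can be defined as the inverse of \<open>y\<close> after
  \<open>H\<close> and \<open>x\<close>; it increases because all three maps do, and it is onto
  because the ranges correspond.\<close>

lemma reparametrize_pos:
  assumes "periodic_C1 F F'" "periodic_C1 G G'" "strict_mono H" "surj H"
    and sgn: "\<And>x. sgn (G (H x)) = sgn (F x)"
    and x: "solves F x" and pos: "F (x 0) > 0"
  shows "\<exists>y \<tau>. solves G y \<and> strict_mono \<tau> \<and> surj \<tau> \<and> H \<circ> x = y \<circ> \<tau>"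
proof -
  interpret F: periodic_C1 F F' by fact
  interpret G: periodic_C1 G G' by fact
  have GH: "G (H u) > 0 \<longleftrightarrow> F u > 0" for u
    using sgn[of u] by (metis sgn_1_pos)
  obtain y where y: "solves G y" "y 0 = H (x 0)" using G.ex_solution by blast
  have Gpos: "G (y 0) > 0" using y(2) GH pos by simp
  have seg: "closed_segment (H a) (H b) = H ` closed_segment a b" for a b
  proof (intro subset_antisym subsetI)
    fix v assume v: "v \<in> closed_segment (H a) (H b)"
    obtain u where "v = H u" using assms(4) by (metis surjD)
    then show "v \<in> H ` closed_segment a b"
      using v strict_mono_less_eq[OF assms(3)] by (auto simp: closed_segment_eq_real_ivl split: if_splits)
  qed (use strict_mono_less_eq[OF assms(3)] in \<open>auto simp: closed_segment_eq_real_ivl\<close>)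
  have range: "H u \<in> range y \<longleftrightarrow> u \<in> range x" for u
    unfolding G.range_solution[OF y(1) Gpos] F.range_solution[OF x pos] y(2) mem_Collect_eq seg
    by (simp add: GH)
  have smx: "strict_mono x" by (rule F.solves_strict_mono[OF x pos])
  have smy: "strict_mono y" by (rule G.solves_strict_mono[OF y(1) Gpos])
  define \<tau> where "\<tau> t = inv y (H (x t))" for t
  have y\<tau>: "y (\<tau> t) = H (x t)" for t
    using range[of "x t"] by (simp add: \<tau>_def f_inv_into_f)
  have "strict_mono \<tau>"
  proof (rule strict_monoI)
    fix a b :: real assume "a < b"
    then have "y (\<tau> a) < y (\<tau> b)"
      using y\<tau> smx assms(3) by (simp add: strict_mono_less)
    then show "\<tau> a < \<tau> b" using smy by (simp add: strict_mono_less)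
  qed
  moreover have "surj \<tau>"
    unfolding surj_def
  proof
    fix s
    obtain u where u: "y s = H u" using assms(4) by (metis surjD)
    then obtain t where "u = x t" using range[of u] by (metis rangeE rangeI)
    then have "y s = y (\<tau> t)" using u y\<tau> by simp
    then have "s = \<tau> t" by (simp add: strict_mono_eq[OF smy])
    then show "\<exists>t. s = \<tau> t" ..
  qed
  moreover have "H \<circ> x = y \<circ> \<tau>" using y\<tau> by auto
  ultimately show ?thesis using y(1) by (intro exI[of _ y] exI[of _ \<tau>]) simp
qed

lemma reparametrize:
  assumes "periodic_C1 F F'" "periodic_C1 G G'" "strict_mono H" "surj H"
    and sgn: "\<And>x. sgn (G (H x)) = sgn (F x)"
    and x: "solves F x"
  shows "\<exists>y \<tau>. solves G y \<and> strict_mono \<tau> \<and> surj \<tau> \<and> H \<circ> x = y \<circ> \<tau>"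
proof -
  interpret F: periodic_C1 F F' by fact
  interpret G: periodic_C1 G G' by fact
  consider "F (x 0) > 0" | "F (x 0) = 0" | "- F (x 0) > 0" by linarith
  then show ?thesis
  proof cases
    case 1
    then show ?thesis using reparametrize_pos assms by blast
  next
    case 2
    have "x t = x 0" for t using F.solves_zero[OF x 2] by simp
    then have "H \<circ> x = (\<lambda>t. H (x 0)) \<circ> id" unfolding fun_eq_iff comp_def by metis
    moreover have "solves G (\<lambda>t. H (x 0))"
      using sgn[of "x 0"] 2 by (intro solves_const) (simp add: sgn_zero_iff)
    moreover have "strict_mono (id :: real \<Rightarrow> real)" by (simp add: strict_mono_def)
    ultimately show ?thesis using surj_id by blast
  next
    case 3
    \<comment> \<open>Reversing time in both systems makes the fields positive; undoing it turns
      \<open>\<tau> t\<close> into \<open>- \<tau> (- t)\<close>, which is increasing again.\<close>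
    obtain y \<tau> where y: "solves (\<lambda>u. - G u) y" and \<tau>: "strict_mono \<tau>" "surj \<tau>"
      and eq: "H \<circ> (\<lambda>t. x (- t)) = y \<circ> \<tau>"
      using reparametrize_pos[OF F.periodic_C1_minus G.periodic_C1_minus assms(3,4) _ solves_reverse[OF x]]
        sgn 3 by (auto simp: sgn_minus)
    have "solves G (\<lambda>t. y (- t))" using solves_reverse[OF y] by simp
    moreover have "strict_mono (\<lambda>t. - \<tau> (- t))" using \<tau>(1) by (simp add: strict_mono_def)
    moreover have "surj (\<lambda>t. - \<tau> (- t))"
      using \<tau>(2) by (metis add.inverse_inverse surj_def)
    moreover have "H \<circ> x = (\<lambda>t. y (- t)) \<circ> (\<lambda>t. - \<tau> (- t))"
      using fun_cong[OF eq, of "- t" for t] by (auto simp: fun_eq_iff)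
    ultimately show ?thesis by blast
  qed
qed

section \<open>Topological equivalence on the circle\<close>

lemma to_circle_shift: "to_circle (x + 1) = to_circle x"
  by (simp add: to_circle_eq_iff)

lemma C1_circle_lift:
  assumes "f \<in> C1_circle"
  shows "periodic_C1 (f \<circ> to_circle) (deriv (f \<circ> to_circle))"
proof -
  obtain D where D: "\<And>x. ((f \<circ> to_circle) has_real_derivative D x) (at x)" "continuous_on UNIV D"
    using assms unfolding C1_circle_def C1_differentiable_on_def
    by (auto simp: has_real_derivative_iff_has_vector_derivative)
  then have "deriv (f \<circ> to_circle) = D" using DERIV_imp_deriv by blast
  then show ?thesis using D by unfold_locales (simp_all add: to_circle_shift)
qed

text \<open>Lets the perturbed fields be constructed on the line.\<close>

lemma periodic_C1_descend:
  assumes "periodic_C1 G G'"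
  obtains g where "g \<in> C1_circle" "g \<circ> to_circle = G"
proof
  interpret G: periodic_C1 G G' by fact
  show lift: "(\<lambda>p. G (rep_circle p)) \<circ> to_circle = G"
  proof
    fix x
    have "rep_circle (to_circle x) - x \<in> \<int>" using to_circle_eq_iff by (metis to_circle_rep_circle)
    then show "((\<lambda>p. G (rep_circle p)) \<circ> to_circle) x = G x"
      using periodic_Ints[of G, OF G.periodic, of "rep_circle (to_circle x) - x" x] by simp
  qed
  show "(\<lambda>p. G (rep_circle p)) \<in> C1_circle"
    unfolding C1_circle_def C1_differentiable_on_def mem_Collect_eq lift
    using G.DERIV G.continuous_deriv
    by (auto simp: has_real_derivative_iff_has_vector_derivative[symmetric])
qed

lemma solution_iff: "solution f c \<longleftrightarrow> (\<exists>x. c = to_circle \<circ> x \<and> solves (f \<circ> to_circle) x)"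
  by (simp add: solution_def solves_def)

lemma solution_shift: "solution f c \<Longrightarrow> solution f (\<lambda>t. c (t + s))"
  unfolding solution_iff using solves_shift by (fastforce simp: fun_eq_iff)

lemma ex_solution_circle:
  assumes "f \<in> C1_circle"
  obtains c where "solution f c" "c 0 = p"
proof -
  interpret periodic_C1 "f \<circ> to_circle" "deriv (f \<circ> to_circle)" by (rule C1_circle_lift[OF assms])
  obtain x where "solves (f \<circ> to_circle) x" "x 0 = rep_circle p" using ex_solution by blast
  then show ?thesis using that[of "to_circle \<circ> x"] by (auto simp: solution_iff)
qed

lemma solution_zero:
  assumes "f \<in> C1_circle" "solution f c" "f (c s) = 0"
  shows "c t = c s"
proof -
  interpret periodic_C1 "f \<circ> to_circle" "deriv (f \<circ> to_circle)" by (rule C1_circle_lift[OF assms(1)])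
  obtain x where "c = to_circle \<circ> x" "solves (f \<circ> to_circle) x"
    using assms(2) by (auto simp: solution_iff)
  then show ?thesis using solves_zero[of x s t] assms(3) by simp
qed

text \<open>The lift \<open>x\<close> that \<open>solution\<close> provides for a constant curve is
  not known to be constant. It has constant speed \<open>f p\<close>, so \<open>f p * t\<close> is
  an integer for every \<open>t\<close>, which forces \<open>f p = 0\<close>.\<close>

lemma solution_const_iff: "solution f (\<lambda>t. p) \<longleftrightarrow> f p = 0"
proof
  assume "solution f (\<lambda>t. p)"
  then obtain x where x: "\<And>t. to_circle (x t) = p" "solves (f \<circ> to_circle) x"
    unfolding solution_iff fun_eq_iff comp_def by metis
  have affine: "x t - x 0 = f p * t" for t
  proof -
    have "\<forall>t. ((\<lambda>t. x t - f p * t) has_real_derivative 0) (at t)"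
      using x by (auto simp: solves_def intro!: derivative_eq_intros)
    from DERIV_isconst_all[OF this, of t 0] show ?thesis by simp
  qed
  have lin: "f p * t \<in> \<int>" for t
    unfolding affine[symmetric] using x(1) to_circle_eq_iff by metis
  show "f p = 0"
  proof (rule ccontr)
    assume "f p \<noteq> 0"
    \<comment> \<open>At this time the displacement \<open>f p * t\<close> equals
      \<open>1 / 2\<close>.\<close>
    then have "(1/2 :: real) \<in> \<int>" using lin[of "1 / (2 * f p)"] by simp
    then show False by (auto elim!: Ints_cases)
  qed
next
  assume "f p = 0"
  then show "solution f (\<lambda>t. p)"
    unfolding solution_iff
    by (intro exI[of _ "\<lambda>t. rep_circle p"]) (auto simp: solves_const)
qed

section \<open>Circle maps induced by lifted homeomorphisms\<close>

definition circle_map :: "(real \<Rightarrow> real) \<Rightarrow> circle \<Rightarrow> circle"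
  where "circle_map H p = to_circle (H (rep_circle p))"

text \<open>The displacement \<open>H x - x\<close> is 1-periodic, so another representative changes
  the value of \<open>H\<close> by the same integer.\<close>

lemma circle_map_to_circle:
  assumes "lifted_homeo H"
  shows "circle_map H (to_circle x) = to_circle (H x)"
proof -
  have "rep_circle (to_circle x) - x \<in> \<int>" using to_circle_eq_iff by (metis to_circle_rep_circle)
  then have "H (rep_circle (to_circle x)) - rep_circle (to_circle x) = H x - x"
    using periodic_Ints[of "\<lambda>x. H x - x" "rep_circle (to_circle x) - x" x] assms
    by (simp add: lifted_homeo_def)
  then have "H (rep_circle (to_circle x)) - H x = rep_circle (to_circle x) - x" by simp
  then show ?thesis
    using \<open>rep_circle (to_circle x) - x \<in> \<int>\<close> by (simp add: circle_map_def to_circle_eq_iff)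
qed

lemma continuous_circle_map:
  assumes "lifted_homeo H"
  shows "continuous_on UNIV (circle_map H)"
proof -
  have "continuous_on UNIV H"
    using assms strict_mono_surj_continuous by (auto simp: lifted_homeo_def)
  moreover have "to_circle -` (circle_map H -` U) = H -` (to_circle -` U)" for U
    using circle_map_to_circle[OF assms] by auto
  ultimately show ?thesis
    by (auto simp: continuous_on_open_vimage open_circle_def)
qed

lemma solution_circle_map:
  assumes "f \<in> C1_circle" "g \<in> C1_circle" "lifted_homeo H"
    and "\<And>x. sgn (g (to_circle (H x))) = sgn (f (to_circle x))"
    and "solution f c"
  shows "\<exists>d \<tau>. solution g d \<and> strict_mono \<tau> \<and> surj \<tau> \<and> continuous_on UNIV \<tau> \<and> circle_map H \<circ> c = d \<circ> \<tau>"
proof -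
  obtain x where c: "c = to_circle \<circ> x" and x: "solves (f \<circ> to_circle) x"
    using assms(5) by (auto simp: solution_iff)
  have "strict_mono H" "surj H" using assms(3) by (auto simp: lifted_homeo_def)
  then obtain y \<tau> where "solves (g \<circ> to_circle) y" "strict_mono \<tau>" "surj \<tau>" "H \<circ> x = y \<circ> \<tau>"
    using reparametrize[OF C1_circle_lift[OF assms(1)] C1_circle_lift[OF assms(2)] _ _ _ x, of H] assms(4)
    unfolding comp_apply by blast
  moreover from this have "circle_map H \<circ> c = (to_circle \<circ> y) \<circ> \<tau>"
    using circle_map_to_circle[OF assms(3)] by (auto simp: c fun_eq_iff)
  ultimately show ?thesis using strict_mono_surj_continuous solution_iff by blast
qed

text \<open>The matching solution \<open>d\<close> passes through \<open>h p\<close> at time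
  \<open>\<tau> 0\<close>; shifting its time makes it start there.\<close>

lemma image_orbit_subset:
  assumes "\<And>c. solution f c \<Longrightarrow> \<exists>d (\<tau> :: real \<Rightarrow> real). solution g d \<and> h \<circ> c = d \<circ> \<tau>"
  shows "h ` orbit f p \<subseteq> orbit g (h p)"
proof
  fix q assume "q \<in> h ` orbit f p"
  then obtain c t where c: "solution f c" "c 0 = p" "q = h (c t)" by (auto simp: orbit_def)
  obtain d and \<tau> :: "real \<Rightarrow> real" where d: "solution g d" "h \<circ> c = d \<circ> \<tau>"
    using assms c(1) by blast
  let ?d = "\<lambda>s. d (s + \<tau> 0)"
  have "solution g ?d" "?d 0 = h p" "q = ?d (\<tau> t - \<tau> 0)"
    using solution_shift[OF d(1)] fun_cong[OF d(2)] c by (auto simp: comp_def)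
  then show "q \<in> orbit g (h p)" unfolding orbit_def mem_Collect_eq
    by (intro exI[of _ ?d] exI[of _ "\<tau> t - \<tau> 0"]) simp
qed

lemma topologically_equivalentI:
  assumes f: "f \<in> C1_circle" and g: "g \<in> C1_circle" and H: "lifted_homeo H"
    and sgn: "\<And>x. sgn (g (to_circle (H x))) = sgn (f (to_circle x))"
  shows "topologically_equivalent f g"
proof -
  let ?h = "circle_map H" and ?k = "circle_map (inv H)"
  have H': "lifted_homeo (inv H)" by (rule lifted_homeo_inv[OF H])
  have "strict_mono H" "surj H" using H by (simp_all add: lifted_homeo_def)
  then have inv: "H (inv H x) = x" "inv H (H x) = x" for x
    by (simp_all add: surj_f_inv_f strict_mono_imp_inj_on inv_f_f)
  have "?h (?k (to_circle x)) = to_circle x" "?k (?h (to_circle x)) = to_circle x" for x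
    by (simp_all add: circle_map_to_circle[OF H] circle_map_to_circle[OF H'] inv)
  from this[of "rep_circle p" for p] have hk: "?h (?k p) = p" "?k (?h p) = p" for p
    by simp_all
  have "homeomorphism UNIV UNIV ?h ?k"
    using hk continuous_circle_map[OF H] continuous_circle_map[OF H']
    by (intro homeomorphismI) auto
  moreover have "maps_oriented_orbits ?h f g"
    unfolding maps_oriented_orbits_def
  proof (intro conjI allI impI)
    fix p
    have fwd: "?h ` orbit f p \<subseteq> orbit g (?h p)"
      using solution_circle_map[OF f g H sgn] by (intro image_orbit_subset) blast
    \<comment> \<open>For the reverse inclusion: \<open>inv H\<close> satisfies the sign condition
      with the two fields exchanged.\<close>
    have "sgn (f (to_circle (inv H x))) = sgn (g (to_circle x))" for x
      using sgn[of "inv H x"] inv by simp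
    then have "?k ` orbit g (?h p) \<subseteq> orbit f (?k (?h p))"
      using solution_circle_map[OF g f H'] by (intro image_orbit_subset) blast
    then have "?h ` ?k ` orbit g (?h p) \<subseteq> ?h ` orbit f p" unfolding hk by (rule image_mono)
    then have "orbit g (?h p) \<subseteq> ?h ` orbit f p" unfolding image_image hk by simp
    then show "\<exists>q. ?h ` orbit f p = orbit g q" using fwd by blast
  qed (rule solution_circle_map[OF f g H sgn])
  ultimately show ?thesis unfolding topologically_equivalent_def by blast
qed

text \<open>Fixed points are the constant solutions. The image of a constant solution is constant
  because the time change is onto. If instead \<open>h p\<close> is fixed, the image of the solution
  through \<open>p\<close> meets a zero of \<open>g\<close>, hence is constant, and injectivity of
  \<open>h\<close> transfers this back.\<close>

lemma equivalent_fixed_points: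
  assumes f: "f \<in> C1_circle" and g: "g \<in> C1_circle" and "topologically_equivalent f g"
  shows "\<exists>h. bij h \<and> h ` fixed_points f = fixed_points g"
proof -
  obtain h k where hk: "homeomorphism UNIV UNIV h k" and maps: "maps_oriented_orbits h f g"
    using assms(3) by (auto simp: topologically_equivalent_def)
  have bij: "bij h" using hk by (intro o_bij[of k]) (auto simp: homeomorphism_def)
  have sol: "\<exists>d (\<tau> :: real \<Rightarrow> real). solution g d \<and> surj \<tau> \<and> (\<forall>t. h (c t) = d (\<tau> t))" if "solution f c" for c
    using maps[unfolded maps_oriented_orbits_def, THEN conjunct2, rule_format, OF that]
  proof (elim exE conjE)
    fix d and \<tau> :: "real \<Rightarrow> real"
    assume "solution g d" "surj \<tau>" "h \<circ> c = d \<circ> \<tau>"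
    then show ?thesis by (intro exI[of _ d] exI[of _ \<tau>]) (simp add: fun_eq_iff)
  qed
  have "g (h p) = 0 \<longleftrightarrow> f p = 0" for p
  proof
    assume "f p = 0"
    then have "solution f (\<lambda>t. p)" by (simp add: solution_const_iff)
    from sol[OF this] obtain d and \<tau> :: "real \<Rightarrow> real"
      where d: "solution g d" "surj \<tau>" "\<And>t. h p = d (\<tau> t)"
      by metis
    have "d = (\<lambda>t. h p)"
    proof
      fix t
      obtain s where "t = \<tau> s" using d(2) by (metis surjD)
      then show "d t = h p" using d(3)[of s] by simp
    qed
    then show "g (h p) = 0" using d(1) by (simp add: solution_const_iff)
  next
    assume g0: "g (h p) = 0"
    obtain c where c: "solution f c" "c 0 = p" using ex_solution_circle[OF f] by blast
    obtain d and \<tau> :: "real \<Rightarrow> real" where d: "solution g d" and eq: "\<And>t. h (c t) = d (\<tau> t)"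
      using sol[OF c(1)] by metis
    have "d (\<tau> t) = d (\<tau> 0)" for t
      by (rule solution_zero[OF g d]) (use g0 c(2) eq in metis)
    then have "h (c t) = h p" for t using eq c(2) by metis
    then have "c = (\<lambda>t. p)" using bij unfolding bij_def fun_eq_iff by (metis injD)
    then show "f p = 0" using c(1) by (simp add: solution_const_iff)
  qed
  then have "h ` fixed_points f = fixed_points g"
    using bij unfolding fixed_points_def by (auto simp: image_iff) (metis bij_pointE)
  then show ?thesis using bij by blast
qed

section \<open>The \<open>C\<^sup>1\<close> topology\<close>

lemma C1_circle_minus:
  assumes "f \<in> C1_circle" "g \<in> C1_circle"
  shows "(\<lambda>p. g p - f p) \<in> C1_circle"
    and "deriv ((\<lambda>p. g p - f p) \<circ> to_circle) x = deriv (g \<circ> to_circle) x - deriv (f \<circ> to_circle) x"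
proof -
  have eq: "(\<lambda>p. g p - f p) \<circ> to_circle = (\<lambda>x. (g \<circ> to_circle) x - (f \<circ> to_circle) x)"
    by auto
  show "(\<lambda>p. g p - f p) \<in> C1_circle"
    using assms unfolding C1_circle_def mem_Collect_eq eq by (intro C1_differentiable_on_diff)
  interpret F: periodic_C1 "f \<circ> to_circle" "deriv (f \<circ> to_circle)" by (rule C1_circle_lift[OF assms(1)])
  interpret G: periodic_C1 "g \<circ> to_circle" "deriv (g \<circ> to_circle)" by (rule C1_circle_lift[OF assms(2)])
  show "deriv ((\<lambda>p. g p - f p) \<circ> to_circle) x = deriv (g \<circ> to_circle) x - deriv (f \<circ> to_circle) x"
    unfolding eq by (intro DERIV_imp_deriv DERIV_diff F.DERIV G.DERIV)
qed

text \<open>A real supremum bounds its terms only when the family is bounded; periodicity and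
  continuity of the lifts ensure this.\<close>

lemma C1_norm_ge:
  assumes "f \<in> C1_circle"
  shows "\<bar>f (to_circle x)\<bar> \<le> C1_norm f" "\<bar>deriv (f \<circ> to_circle) x\<bar> \<le> C1_norm f"
proof -
  interpret F: periodic_C1 "f \<circ> to_circle" "deriv (f \<circ> to_circle)" by (rule C1_circle_lift[OF assms])
  obtain A where A: "\<And>x. \<bar>(f \<circ> to_circle) x\<bar> \<le> A"
    using periodic_bounded[of "f \<circ> to_circle", OF F.periodic F.continuous] by blast
  obtain B where B: "\<And>x. \<bar>deriv (f \<circ> to_circle) x\<bar> \<le> B"
    using periodic_bounded[of "deriv (f \<circ> to_circle)", OF F.periodic_deriv F.continuous_deriv] by blast
  have "\<bar>f p\<bar> \<le> A" for p using A[of "rep_circle p"] by simp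
  then have 1: "\<bar>f p\<bar> \<le> (SUP p. \<bar>f p\<bar>)" for p by (intro cSUP_upper bdd_aboveI2[of _ _ A]) auto
  have "\<bar>circle_deriv f p\<bar> \<le> B" for p using B by (simp add: circle_deriv_def)
  then have 2: "\<bar>circle_deriv f p\<bar> \<le> (SUP p. \<bar>circle_deriv f p\<bar>)" for p
    by (intro cSUP_upper bdd_aboveI2[of _ _ B]) auto
  have 3: "0 \<le> (SUP p. \<bar>f p\<bar>)" "0 \<le> (SUP p. \<bar>circle_deriv f p\<bar>)"
    using 1 2 abs_ge_zero order_trans by blast+
  show "\<bar>f (to_circle x)\<bar> \<le> C1_norm f" "\<bar>deriv (f \<circ> to_circle) x\<bar> \<le> C1_norm f"
    unfolding C1_norm_def using 1[of "to_circle x"] 2[of "to_circle x"] 3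
    by (simp_all add: circle_deriv_to_circle)
qed

lemma C1_norm_le:
  assumes "\<And>x. \<bar>f (to_circle x)\<bar> \<le> A" "\<And>x. \<bar>deriv (f \<circ> to_circle) x\<bar> \<le> B"
  shows "C1_norm f \<le> A + B"
  unfolding C1_norm_def
proof (intro add_mono cSUP_least)
  show "\<bar>f p\<bar> \<le> A" for p using assms(1)[of "rep_circle p"] by simp
  show "\<bar>circle_deriv f p\<bar> \<le> B" for p using assms(2) by (simp add: circle_deriv_def)
qed auto

lemma C1_ballD:
  assumes "f \<in> C1_circle" "g \<in> C1_ball f \<epsilon>"
  shows "g \<in> C1_circle" "\<bar>g (to_circle x) - f (to_circle x)\<bar> < \<epsilon>"
    "\<bar>deriv (g \<circ> to_circle) x - deriv (f \<circ> to_circle) x\<bar> < \<epsilon>"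
proof -
  show g: "g \<in> C1_circle" using assms(2) by (simp add: C1_ball_def)
  have "C1_norm (\<lambda>p. g p - f p) < \<epsilon>" using assms(2) by (simp add: C1_ball_def)
  then show "\<bar>g (to_circle x) - f (to_circle x)\<bar> < \<epsilon>"
    "\<bar>deriv (g \<circ> to_circle) x - deriv (f \<circ> to_circle) x\<bar> < \<epsilon>"
    using C1_norm_ge[OF C1_circle_minus(1)[OF assms(1) g], of x]
    by (simp_all add: C1_circle_minus(2)[OF assms(1) g])
qed

lemma C1_ballI:
  assumes "f \<in> C1_circle" "g \<in> C1_circle" "A + B < \<epsilon>"
    and "\<And>x. \<bar>g (to_circle x) - f (to_circle x)\<bar> \<le> A"
    and "\<And>x. \<bar>deriv (g \<circ> to_circle) x - deriv (f \<circ> to_circle) x\<bar> \<le> B"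
  shows "g \<in> C1_ball f \<epsilon>"
  unfolding C1_ball_def using assms(2,3) C1_norm_le[of "\<lambda>p. g p - f p" A B] assms(4,5)
  by (simp add: C1_circle_minus(2)[OF assms(1,2)])

text \<open>The balls are nested, so one radius settles all smaller ones.\<close>

lemma structurally_stable_iff:
  "C1_structurally_stable f \<longleftrightarrow> (\<exists>\<epsilon>>0. \<forall>g \<in> C1_ball f \<epsilon>. topologically_equivalent f g)"
proof
  assume "C1_structurally_stable f"
  then show "\<exists>\<epsilon>>0. \<forall>g \<in> C1_ball f \<epsilon>. topologically_equivalent f g"
    unfolding C1_structurally_stable_def eventually_at_right_field by (meson dense)
next
  assume "\<exists>\<epsilon>>0. \<forall>g \<in> C1_ball f \<epsilon>. topologically_equivalent f g"
  then obtain \<epsilon> where "\<epsilon> > 0" "\<And>g. g \<in> C1_ball f \<epsilon> \<Longrightarrow> topologically_equivalent f g" by blast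
  then show "C1_structurally_stable f"
    unfolding C1_structurally_stable_def eventually_at_right_field
    by (intro exI[of _ \<epsilon>]) (auto simp: C1_ball_def)
qed

section \<open>Hyperbolic fixed points persist\<close>

text \<open>A spike of height 1 and half-width \<open>r\<close> over every lift of \<open>p\<close>.
  Measuring the distance to the whole fibre makes it 1-periodic.\<close>

definition tent :: "real \<Rightarrow> circle \<Rightarrow> real \<Rightarrow> real"
  where "tent r p x = max 0 (1 - infdist x (to_circle -` {p}) / r)"

lemma tent_range: "r > 0 \<Longrightarrow> 0 \<le> tent r p x" "r > 0 \<Longrightarrow> tent r p x \<le> 1"
  by (simp_all add: tent_def infdist_nonneg)

lemma tent_Lipschitz:
  assumes "r > 0"
  shows "\<bar>tent r p x - tent r p y\<bar> \<le> \<bar>x - y\<bar> / r"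
proof -
  let ?d = "\<lambda>x. infdist x (to_circle -` {p})"
  have "\<bar>tent r p x - tent r p y\<bar> \<le> \<bar>?d x / r - ?d y / r\<bar>" by (auto simp: tent_def)
  also have "\<dots> = \<bar>?d x - ?d y\<bar> / r" using assms by (simp add: diff_divide_distrib[symmetric])
  also have "\<dots> \<le> \<bar>x - y\<bar> / r"
    using infdist_triangle_abs[of x _ y] assms by (intro divide_right_mono) (auto simp: dist_real_def)
  finally show ?thesis .
qed

lemma tent_shift: "tent r p (x + 1) = tent r p x"
proof -
  let ?A = "to_circle -` {p}"
  have "?A = (\<lambda>a. a + 1) ` ?A"
  proof (intro subset_antisym subsetI)
    fix a assume "a \<in> ?A"
    then have "a - 1 \<in> ?A" using to_circle_shift[of "a - 1"] by simp
    then show "a \<in> (\<lambda>a. a + 1) ` ?A" by (intro image_eqI[of _ _ "a - 1"]) auto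
  qed (auto simp: to_circle_shift)
  then have "infdist (x + 1) ?A = infdist (x + 1) ((\<lambda>a. a + 1) ` ?A)" by simp
  also have "\<dots> = infdist x ?A" by (simp add: infdist_def image_image)
  finally show ?thesis by (simp add: tent_def)
qed

lemma tent_eq_1: "to_circle z = p \<Longrightarrow> tent r p z = 1"
  by (simp add: tent_def)

lemma tent_eq_0:
  assumes "r > 0" "\<And>a. to_circle a = p \<Longrightarrow> r \<le> \<bar>x - a\<bar>"
  shows "tent r p x = 0"
proof -
  \<comment> \<open>The distance to an empty set is 0 by convention, so the fibre has to be shown
    nonempty.\<close>
  have "rep_circle p \<in> to_circle -` {p}" by simp
  then have "to_circle -` {p} \<noteq> {}" by blast
  then have "r \<le> infdist x (to_circle -` {p})"
    unfolding infdist_def using assms(2)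
    by (auto simp: dist_real_def simp del: vimage_singleton_eq intro!: cINF_greatest)
  then show ?thesis using assms(1) by (simp add: tent_def)
qed

text \<open>Each tent has slope at most \<open>1 / r\<close>, so the bound on \<open>e\<close> makes
  the added sum Lipschitz with constant \<open>1 / 2\<close>; hence the map increases strictly.
  Boundedness of the sum makes it onto. The \<open>+ 1\<close> keeps the bound positive when
  \<open>P\<close> is empty.\<close>

lemma lifted_homeo_tent:
  assumes "finite P" "r > 0" and e: "\<And>p. p \<in> P \<Longrightarrow> \<bar>e p\<bar> \<le> r / (2 * (real (card P) + 1))"
  shows "lifted_homeo (\<lambda>x. x + (\<Sum>p\<in>P. e p * tent r p x))"
proof -
  define \<psi> where "\<psi> x = (\<Sum>p\<in>P. e p * tent r p x)" for x
  let ?N = "real (card P)"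
  have Lip: "\<bar>\<psi> x - \<psi> y\<bar> \<le> \<bar>x - y\<bar> / 2" for x y
  proof -
    have "\<bar>\<psi> x - \<psi> y\<bar> = \<bar>\<Sum>p\<in>P. e p * (tent r p x - tent r p y)\<bar>"
      by (simp add: \<psi>_def sum_subtractf right_diff_distrib)
    also have "\<dots> \<le> (\<Sum>p\<in>P. \<bar>e p * (tent r p x - tent r p y)\<bar>)" by (rule sum_abs)
    also have "\<dots> \<le> (\<Sum>p\<in>P. r / (2 * (?N + 1)) * (\<bar>x - y\<bar> / r))"
      unfolding abs_mult using e tent_Lipschitz[OF assms(2)] assms(2)
      by (intro sum_mono mult_mono) auto
    also have "\<dots> = (?N / (?N + 1)) * (\<bar>x - y\<bar> / 2)" using assms(2) by simp
    also have "\<dots> \<le> 1 * (\<bar>x - y\<bar> / 2)" by (intro mult_right_mono) auto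
    finally show ?thesis by simp
  qed
  have mono: "strict_mono (\<lambda>x. x + \<psi> x)"
  proof (rule strict_monoI)
    fix x y :: real assume "x < y"
    then show "x + \<psi> x < y + \<psi> y" using Lip[of x y] by (simp add: abs_if split: if_splits)
  qed
  have cont: "continuous_on S (\<lambda>x. x + \<psi> x)" for S
    unfolding \<psi>_def tent_def by (intro continuous_intros) (use assms(2) in auto)
  have "surj (\<lambda>x. x + \<psi> x)"
    unfolding surj_def
  proof
    fix y
    define b where "b = (\<Sum>p\<in>P. \<bar>e p\<bar>)"
    have b: "\<bar>\<psi> x\<bar> \<le> b" for x
    proof -
      have "\<bar>\<psi> x\<bar> \<le> (\<Sum>p\<in>P. \<bar>e p * tent r p x\<bar>)" unfolding \<psi>_def by (rule sum_abs)
      also have "\<dots> \<le> b"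
        unfolding b_def abs_mult using tent_range[OF assms(2)]
        by (intro sum_mono mult_left_le) auto
      finally show ?thesis .
    qed
    have "b \<ge> 0" unfolding b_def by (simp add: sum_nonneg)
    then obtain x where "x + \<psi> x = y"
      using IVT'[of "\<lambda>x. x + \<psi> x" "y - b" y "y + b"] cont
        b[of "y - b", unfolded abs_le_iff] b[of "y + b", unfolded abs_le_iff] by auto
    then show "\<exists>x. y = x + \<psi> x" by blast
  qed
  then show ?thesis
    using mono unfolding lifted_homeo_def \<psi>_def by (simp add: tent_shift)
qed

text \<open>By the mean value theorem, \<open>\<Phi> x = (x - w) * D u\<close> for some
  \<open>u\<close> between the two points.\<close>

lemma sgn_near_simple_zero:
  fixes \<Phi> :: "real \<Rightarrow> real"
  assumes D: "\<And>u. u \<in> closed_segment w x \<Longrightarrow> (\<Phi> has_real_derivative D u) (at u)"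
    and \<sigma>: "\<And>u. u \<in> closed_segment w x \<Longrightarrow> sgn (D u) = \<sigma>" and "\<Phi> w = 0"
  shows "sgn (\<Phi> x) = \<sigma> * sgn (x - w)"
proof -
  consider "w < x" | "x = w" | "x < w" by linarith
  then show ?thesis
  proof cases
    case 1
    then obtain u where "u \<in> {w<..<x}" "\<Phi> x - \<Phi> w = (x - w) * D u"
      using MVT2[of w x \<Phi> D] D by (auto simp: closed_segment_eq_real_ivl)
    then show ?thesis using 1 \<sigma>[of u] assms(3) by (simp add: closed_segment_eq_real_ivl sgn_mult)
  next
    case 3
    then obtain u where "u \<in> {x<..<w}" "\<Phi> w - \<Phi> x = (w - x) * D u"
      using MVT2[of x w \<Phi> D] D by (auto simp: closed_segment_eq_real_ivl)
    moreover from this have "\<Phi> x = (x - w) * D u" using assms(3) by (simp add: algebra_simps)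
    ultimately show ?thesis using 3 \<sigma>[of u] by (simp add: closed_segment_eq_real_ivl sgn_mult)
  qed (use assms(3) in auto)
qed

text \<open>A single number serves as radius and as lower bound for the slope. It is found by
  continuity of the derivative at each representative and carried to all lifts by
  periodicity.\<close>

lemma hyperbolic_radius:
  assumes f: "f \<in> C1_circle" and fin: "finite (fixed_points f)"
    and hyp: "\<forall>p \<in> fixed_points f. hyperbolic f p"
  obtains \<rho> where "\<rho> > 0"
    "\<And>z x. f (to_circle z) = 0 \<Longrightarrow> \<bar>x - z\<bar> \<le> \<rho> \<Longrightarrow>
      \<rho> \<le> deriv (f \<circ> to_circle) x * sgn (deriv (f \<circ> to_circle) z)"
proof -
  define F' where "F' = deriv (f \<circ> to_circle)"
  interpret F: periodic_C1 "f \<circ> to_circle" F' unfolding F'_def by (rule C1_circle_lift[OF f])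
  have "\<forall>\<^sub>F \<rho> in at_right 0. \<forall>x. \<bar>x - rep_circle p\<bar> \<le> \<rho> \<longrightarrow> \<rho> \<le> F' x * sgn (F' (rep_circle p))"
    if "p \<in> fixed_points f" for p
  proof -
    let ?z = "rep_circle p"
    have c: "\<bar>F' ?z\<bar> > 0"
      using hyp that by (auto simp: hyperbolic_def circle_deriv_def F'_def)
    have "isCont F' ?z" using F.continuous_deriv continuous_on_eq_continuous_at by blast
    then obtain d where d: "d > 0" "\<And>x. \<bar>x - ?z\<bar> < d \<Longrightarrow> \<bar>F' x - F' ?z\<bar> < \<bar>F' ?z\<bar> / 2"
      using c unfolding continuous_at_eps_delta by (metis dist_real_def half_gt_zero)
    show ?thesis
      unfolding eventually_at_right_field
    proof (intro exI conjI allI impI)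
      show "0 < min d (\<bar>F' ?z\<bar> / 2)" using c d(1) by simp
      fix \<rho> x assume "0 < \<rho>" "\<rho> < min d (\<bar>F' ?z\<bar> / 2)" "\<bar>x - ?z\<bar> \<le> \<rho>"
      then show "\<rho> \<le> F' x * sgn (F' ?z)"
        using d(2)[of x] c by (auto simp: sgn_if abs_if split: if_splits)
    qed
  qed
  \<comment> \<open>Finiteness of the fixed points gives one radius for all of them.\<close>
  then have "\<forall>\<^sub>F \<rho> in at_right 0. \<forall>p \<in> fixed_points f. \<forall>x. \<bar>x - rep_circle p\<bar> \<le> \<rho> \<longrightarrow>
      \<rho> \<le> F' x * sgn (F' (rep_circle p))"
    using fin by (intro eventually_ball_finite) auto
  then obtain \<rho> where \<rho>: "\<rho> > 0" "\<And>p x. p \<in> fixed_points f \<Longrightarrow> \<bar>x - rep_circle p\<bar> \<le> \<rho> \<Longrightarrow>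
      \<rho> \<le> F' x * sgn (F' (rep_circle p))"
    unfolding eventually_at_right_field by (metis dense)
  show ?thesis
  proof (rule that[OF \<rho>(1)])
    fix z x assume z: "f (to_circle z) = 0" "\<bar>x - z\<bar> \<le> \<rho>"
    define n where "n = rep_circle (to_circle z) - z"
    have "n \<in> \<int>" unfolding n_def using to_circle_eq_iff by (metis to_circle_rep_circle)
    then have "F' (x + n) = F' x" "F' (z + n) = F' z"
      using periodic_Ints[of F', OF F.periodic_deriv] by auto
    moreover have "z + n = rep_circle (to_circle z)" by (simp add: n_def)
    ultimately show "\<rho> \<le> deriv (f \<circ> to_circle) x * sgn (deriv (f \<circ> to_circle) z)"
      using \<rho>(2)[of "to_circle z" "x + n"] z unfolding F'_def[symmetric]
      by (simp add: fixed_points_def n_def)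
  qed
qed

text \<open>Within one period the points at distance at least \<open>\<eta>\<close> from all zeros
  form a compact set, on which \<open>\<bar>F\<bar>\<close> has a positive minimum unless the set is
  empty.\<close>

lemma bounded_away_from_zeros:
  assumes "periodic_C1 F F'" "\<eta> > 0"
  obtains m where "m > 0" "\<And>x. (\<And>z. F z = 0 \<Longrightarrow> \<eta> \<le> \<bar>x - z\<bar>) \<Longrightarrow> m \<le> \<bar>F x\<bar>"
proof -
  interpret periodic_C1 F F' by fact
  define K where "K = {0..1} \<inter> (\<Inter>z\<in>{z. F z = 0}. {x. \<eta> \<le> \<bar>x - z\<bar>})"
  have "compact K"
    unfolding K_def by (intro compact_Int_closed closed_INT ballI closed_Collect_le continuous_intros) auto
  obtain m where m: "m > 0" "\<And>x. x \<in> K \<Longrightarrow> m \<le> \<bar>F x\<bar>"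
  proof (cases "K = {}")
    case True
    then show ?thesis using that[of 1] by auto
  next
    case False
    then obtain a where a: "a \<in> K" "\<And>x. x \<in> K \<Longrightarrow> \<bar>F a\<bar> \<le> \<bar>F x\<bar>"
      using continuous_attains_inf[OF \<open>compact K\<close>, of "\<lambda>x. \<bar>F x\<bar>"] continuous
      by (auto intro: continuous_on_rabs)
    have "F a \<noteq> 0" using a(1) assms(2) by (auto simp: K_def)
    then show ?thesis using that[of "\<bar>F a\<bar>"] a(2) by auto
  qed
  show ?thesis
  proof (rule that[OF m(1)])
    fix x assume x: "\<And>z. F z = 0 \<Longrightarrow> \<eta> \<le> \<bar>x - z\<bar>"
    have "frac x \<in> K"
      unfolding K_def
    proof (intro IntI INT_I)
      fix z assume "z \<in> {z. F z = 0}"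
      then have "F (z + of_int \<lfloor>x\<rfloor>) = 0"
        using periodic_Ints[of F "of_int \<lfloor>x\<rfloor>" z, OF periodic] by simp
      from x[OF this] show "frac x \<in> {x. \<eta> \<le> \<bar>x - z\<bar>}" by (simp add: frac_def algebra_simps)
    qed (use frac_lt_1[of x] in \<open>simp add: less_imp_le\<close>)
    then show "m \<le> \<bar>F x\<bar>" using m(2) periodic_frac[of F x, OF periodic] by metis
  qed
qed

text \<open>Closeness below \<open>m\<close> preserves the sign of the field off the
  \<open>\<eta>\<close>-neighbourhoods of the zeros, and closeness of derivatives below
  \<open>\<rho>\<close> preserves the sign of the slope within distance \<open>\<rho>\<close> of a
  zero. Hence the radius \<open>min m \<rho>\<close>.\<close>

lemma hyperbolic_lifted_homeo:
  assumes f: "f \<in> C1_circle" and fin: "finite (fixed_points f)"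
    and hyp: "\<forall>p \<in> fixed_points f. hyperbolic f p"
  obtains \<epsilon> where "\<epsilon> > 0"
    "\<And>g. g \<in> C1_ball f \<epsilon> \<Longrightarrow>
      \<exists>H. lifted_homeo H \<and> (\<forall>x. sgn (g (to_circle (H x))) = sgn (f (to_circle x)))"
proof -
  define F where "F = f \<circ> to_circle"
  define F' where "F' = deriv F"
  interpret F: periodic_C1 F F' unfolding F'_def F_def by (rule C1_circle_lift[OF f])
  let ?P = "fixed_points f"
  obtain \<rho> where \<rho>: "\<rho> > 0" "\<And>z x. F z = 0 \<Longrightarrow> \<bar>x - z\<bar> \<le> \<rho> \<Longrightarrow> \<rho> \<le> F' x * sgn (F' z)"
    using hyperbolic_radius[OF f fin hyp] unfolding F'_def F_def by auto
  \<comment> \<open>Distinct zeros are more than \<open>\<rho>\<close> apart (see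
    \<open>sep\<close>), so tents of half-width \<open>\<rho> / 2\<close> about them do not
    overlap.\<close>
  define r where "r = \<rho> / 2"
  have r: "r > 0" "r < \<rho>" using \<rho>(1) by (auto simp: r_def)
  \<comment> \<open>The largest shift of a zero that \<open>lifted_homeo_tent\<close>
    permits.\<close>
  define \<eta> where "\<eta> = r / (2 * (real (card ?P) + 1))"
  have \<eta>: "\<eta> > 0" "\<eta> \<le> r"
    using r(1) by (auto simp: \<eta>_def field_simps intro: order_trans[of r "2 * r"])
  obtain m where m: "m > 0" "\<And>x. (\<And>z. F z = 0 \<Longrightarrow> \<eta> \<le> \<bar>x - z\<bar>) \<Longrightarrow> m \<le> \<bar>F x\<bar>"
    using bounded_away_from_zeros[OF F.periodic_C1_axioms \<eta>(1)] by blast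
  have seg: "\<bar>u - z\<bar> \<le> \<delta>" if "u \<in> closed_segment a b" "\<bar>a - z\<bar> \<le> \<delta>" "\<bar>b - z\<bar> \<le> \<delta>" for u z a b \<delta> :: real
    using that by (auto simp: closed_segment_eq_real_ivl abs_if split: if_splits)
  have sgnF': "sgn (F' u) = sgn (F' z)" "sgn (F' z) \<noteq> 0" if "F z = 0" "\<bar>u - z\<bar> \<le> \<rho>" for u z
    using \<rho>(2)[OF that] \<rho>(1) by (auto simp: sgn_if split: if_splits)
  have sgnF: "sgn (F x) = sgn (F' z) * sgn (x - z)" if "F z = 0" "\<bar>x - z\<bar> \<le> \<rho>" for x z
  proof (rule sgn_near_simple_zero[OF F.DERIV _ that(1)])
    fix u assume "u \<in> closed_segment z x"
    from seg[OF this, of z \<rho>] show "sgn (F' u) = sgn (F' z)"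
      using that \<rho>(1) by (intro sgnF'(1)) auto
  qed
  have sep: "\<rho> < \<bar>z' - z\<bar>" if "F z = 0" "F z' = 0" "z \<noteq> z'" for z z'
  proof (rule ccontr)
    assume "\<not> \<rho> < \<bar>z' - z\<bar>"
    then have "sgn (F z') = sgn (F' z) * sgn (z' - z)" using that(1) by (intro sgnF) auto
    then show False using sgnF'(2)[of z z] that \<rho>(1) by (simp add: sgn_zero_iff)
  qed
  \<comment> \<open>A point at distance \<open>\<delta>\<close> from one zero is at least as far
    from every other one, so the hypotheses of \<open>sgnG\<close> and \<open>H_far\<close> can be
    met.\<close>
  have far: "\<delta> \<le> \<bar>x - a\<bar>" if "F z = 0" "F a = 0" "\<bar>x - z\<bar> = \<delta>" "\<delta> \<le> r" for x z a \<delta>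
  proof (cases "a = z")
    case False
    then have "2 * r < \<bar>a - z\<bar>" using sep[OF that(1,2)] by (simp add: r_def)
    then show ?thesis using that(3,4) by linarith
  qed (use that in simp)
  show ?thesis
  proof (rule that[of "min m \<rho>"])
    show "0 < min m \<rho>" using m(1) \<rho>(1) by simp
    fix g assume "g \<in> C1_ball f (min m \<rho>)"
    note g = C1_ballD[OF f this]
    define G where "G = g \<circ> to_circle"
    define G' where "G' = deriv G"
    interpret G: periodic_C1 G G' unfolding G'_def G_def by (rule C1_circle_lift[OF g(1)])
    have close: "\<bar>G x - F x\<bar> < m" "\<bar>G' x - F' x\<bar> < \<rho>" for x
      using g(2,3)[of x] by (simp_all add: G'_def G_def F'_def F_def)
    have sgnG': "sgn (G' x) = sgn (F' z)" if "F z = 0" "\<bar>x - z\<bar> \<le> \<rho>" for x z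
      using \<rho>(2)[OF that] \<rho>(1) close(2)[of x] by (auto simp: sgn_if split: if_splits)
    have sgnG: "sgn (G x) = sgn (F x)" if "\<And>z. F z = 0 \<Longrightarrow> \<eta> \<le> \<bar>x - z\<bar>" for x
      using m(2)[OF that] close(1)[of x] m(1) by (auto simp: sgn_if abs_if split: if_splits)
    \<comment> \<open>\<open>G\<close> inherits from \<open>F\<close> opposite signs at the two
      points at distance \<open>\<eta>\<close> from the zero, so it vanishes in between.\<close>
    have "\<exists>e. \<bar>e\<bar> \<le> \<eta> \<and> G (rep_circle p + e) = 0" if "p \<in> ?P" for p
    proof -
      let ?z = "rep_circle p"
      have z: "F ?z = 0" using that by (simp add: F_def fixed_points_def)
      have "sgn (G x) = sgn (F' ?z) * sgn (x - ?z)" if "\<bar>x - ?z\<bar> = \<eta>" for x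
        using sgnG[OF far[OF z _ that \<eta>(2)]] sgnF[OF z, of x] that \<eta>(2) r(2) by simp
      from this[of "?z + \<eta>"] this[of "?z - \<eta>"]
      have "sgn (G (?z + \<eta>)) = sgn (F' ?z)" "sgn (G (?z - \<eta>)) = - sgn (F' ?z)"
        using \<eta>(1) by simp_all
      then have "\<exists>x. ?z - \<eta> \<le> x \<and> x \<le> ?z + \<eta> \<and> G x = 0"
        using \<eta>(1) IVT'[of G "?z - \<eta>" 0 "?z + \<eta>"] IVT2'[of G "?z + \<eta>" 0 "?z - \<eta>"] G.continuous
        by (auto simp: sgn_if split: if_splits)
      then obtain x where "?z - \<eta> \<le> x" "x \<le> ?z + \<eta>" "G x = 0" by blast
      then show ?thesis by (intro exI[of _ "x - ?z"]) auto
    qed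
    then obtain e where e: "\<And>p. p \<in> ?P \<Longrightarrow> \<bar>e p\<bar> \<le> \<eta>" "\<And>p. p \<in> ?P \<Longrightarrow> G (rep_circle p + e p) = 0"
      by metis
    define H where "H x = x + (\<Sum>p\<in>?P. e p * tent r p x)" for x
    have H: "lifted_homeo H"
      unfolding H_def using fin r(1) e(1) unfolding \<eta>_def by (rule lifted_homeo_tent)
    then have mono: "strict_mono H" by (simp add: lifted_homeo_def)
    have H_far: "H x = x" if "\<And>z. F z = 0 \<Longrightarrow> r \<le> \<bar>x - z\<bar>" for x
    proof -
      have "tent r p x = 0" if "p \<in> ?P" for p
        using that \<open>\<And>z. F z = 0 \<Longrightarrow> r \<le> \<bar>x - z\<bar>\<close>
        by (intro tent_eq_0 r(1)) (auto simp: F_def fixed_points_def)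
      then show ?thesis by (simp add: H_def)
    qed
    have H_zero: "H z = z + e (to_circle z)" if z: "F z = 0" for z
    proof -
      have "tent r p z = (if p = to_circle z then 1 else 0)" if "p \<in> ?P" for p
      proof (cases "p = to_circle z")
        case False
        have "r \<le> \<bar>z - a\<bar>" if a: "to_circle a = p" for a
        proof -
          have "F a = 0" "z \<noteq> a"
            using False a \<open>p \<in> ?P\<close> by (auto simp: F_def fixed_points_def)
          then show ?thesis using sep[OF z] r(2) by (simp add: abs_minus_commute less_imp_le order.strict_trans)
        qed
        then show ?thesis using False by (simp add: tent_eq_0 r(1))
      qed (simp add: tent_eq_1)
      moreover have "to_circle z \<in> ?P" using z by (simp add: F_def fixed_points_def)
      ultimately show ?thesis using fin by (simp add: H_def if_distrib[of "(*) _"] cong: if_cong)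
    qed
    have G_zero: "G (H z) = 0" if z: "F z = 0" for z
    proof -
      let ?p = "to_circle z"
      have "rep_circle ?p - z \<in> \<int>" using to_circle_eq_iff by (metis to_circle_rep_circle)
      then have "G (H z + (rep_circle ?p - z)) = G (H z)"
        by (rule periodic_Ints[of G, OF G.periodic])
      moreover have "G (rep_circle ?p + e ?p) = 0"
        using e(2)[of ?p] z by (simp add: F_def fixed_points_def)
      ultimately show ?thesis by (simp add: H_zero[OF z] algebra_simps)
    qed
    have "sgn (G (H x)) = sgn (F x)" for x
    proof (cases "\<exists>z. F z = 0 \<and> \<bar>x - z\<bar> < r")
      case False
      then have "H x = x" by (intro H_far) (auto simp: not_less)
      moreover have "sgn (G x) = sgn (F x)"
        using False \<eta>(2) by (intro sgnG) (meson not_less order_trans)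
      ultimately show ?thesis by simp
    next
      case True
      then obtain z where z: "F z = 0" "\<bar>x - z\<bar> < r" by blast
      \<comment> \<open>\<open>H\<close> fixes both ends of the interval about \<open>z\<close>, so
        by monotonicity \<open>H x\<close> stays where the derivative of \<open>G\<close> has the
        sign of \<open>F' z\<close>.\<close>
      have "H (z - r) = z - r" "H (z + r) = z + r"
        using far[OF z(1), of _ _ r] r(1) by (auto intro!: H_far)
      moreover have "H (z - r) < H x" "H x < H (z + r)"
        using z(2) mono by (auto simp: strict_mono_less abs_if split: if_splits)
      ultimately have Hx: "\<bar>H x - z\<bar> \<le> \<rho>" using r by (simp add: abs_if)
      have Hz: "\<bar>H z - z\<bar> \<le> \<rho>"
        using H_zero[OF z(1)] e(1)[of "to_circle z"] z(1) \<eta> r by (simp add: F_def fixed_points_def)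
      have "sgn (G (H x)) = sgn (F' z) * sgn (H x - H z)"
        by (rule sgn_near_simple_zero[OF G.DERIV sgnG'[OF z(1) seg[OF _ Hz Hx]] G_zero[OF z(1)]])
      also have "sgn (H x - H z) = sgn (x - z)"
        using strict_mono_less[OF mono, of x z] strict_mono_eq[OF mono, of x z] by (auto simp: sgn_if)
      also have "sgn (F' z) * sgn (x - z) = sgn (F x)" using sgnF[OF z(1), of x] z(2) r(2) by simp
      finally show ?thesis .
    qed
    then show "\<exists>H. lifted_homeo H \<and> (\<forall>x. sgn (g (to_circle (H x))) = sgn (f (to_circle x)))"
      using H by (auto simp: F_def G_def)
  qed
qed

lemma hyperbolic_imp_stable:
  assumes f: "f \<in> C1_circle" and "finite (fixed_points f)" "\<forall>p \<in> fixed_points f. hyperbolic f p"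
  shows "C1_structurally_stable f"
proof -
  obtain \<epsilon> where \<epsilon>: "\<epsilon> > 0" "\<And>g. g \<in> C1_ball f \<epsilon> \<Longrightarrow>
      \<exists>H. lifted_homeo H \<and> (\<forall>x. sgn (g (to_circle (H x))) = sgn (f (to_circle x)))"
    using hyperbolic_lifted_homeo[OF assms] by blast
  have "topologically_equivalent f g" if g: "g \<in> C1_ball f \<epsilon>" for g
    using \<epsilon>(2)[OF g] topologically_equivalentI[OF f C1_ballD(1)[OF f g]] by blast
  then show ?thesis using \<epsilon>(1) structurally_stable_iff by blast
qed

section \<open>Stable systems are hyperbolic\<close>

text \<open>Infinitely many zeros would accumulate at a zero \<open>z\<close>; the difference
  quotients at \<open>z\<close> vanish along them, against \<open>F' z \<noteq> 0\<close>.\<close>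

lemma finite_simple_zeros:
  assumes "periodic_C1 F F'" and simple: "\<And>z. F z = 0 \<Longrightarrow> F' z \<noteq> 0"
  shows "finite {z \<in> {0..1}. F z = 0}" (is "finite ?S")
proof (rule ccontr)
  interpret periodic_C1 F F' by fact
  assume "infinite ?S"
  moreover have "\<forall>T. infinite T \<and> T \<subseteq> {0..1} \<longrightarrow> (\<exists>x\<in>{0..1::real}. x islimpt T)"
    using compact_Icc unfolding compact_eq_Bolzano_Weierstrass .
  moreover have "?S \<subseteq> {0..1}" by blast
  ultimately obtain z where "z islimpt ?S" by metis
  then have lim: "z islimpt {z. F z = 0}" by (rule islimpt_subset) auto
  have "closed {z. F z = 0}"
    using continuous_closed_preimage_constant[OF continuous[of UNIV]] by simp
  then have z: "F z = 0" using lim closed_limpt by blast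
  have "((\<lambda>x. (F x - F z) / (x - z)) \<longlongrightarrow> F' z) (at z)"
    using DERIV[of z] by (simp add: has_field_derivative_iff)
  then have "\<forall>\<^sub>F x in at z. (F x - F z) / (x - z) \<noteq> 0"
    using simple[OF z] by (rule tendsto_imp_eventually_ne)
  then have "\<forall>\<^sub>F x in at z. x \<notin> {z. F z = 0}"
    by (rule eventually_mono) (use z in auto)
  then show False using lim by (simp add: islimpt_iff_eventually)
qed

lemma finite_fixed_points:
  assumes "f \<in> C1_circle" "\<And>z. f (to_circle z) = 0 \<Longrightarrow> deriv (f \<circ> to_circle) z \<noteq> 0"
  shows "finite (fixed_points f)"
proof (rule finite_surj)
  show "finite {z \<in> {0..1}. (f \<circ> to_circle) z = 0}"
    using assms(2) by (intro finite_simple_zeros[OF C1_circle_lift[OF assms(1)]]) auto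
  show "fixed_points f \<subseteq> to_circle ` {z \<in> {0..1}. (f \<circ> to_circle) z = 0}"
  proof
    fix p assume p: "p \<in> fixed_points f"
    have eq: "to_circle (frac (rep_circle p)) = p"
      using periodic_frac[of to_circle, OF to_circle_shift] by simp
    then show "p \<in> to_circle ` {z \<in> {0..1}. (f \<circ> to_circle) z = 0}"
      using p frac_lt_1[of "rep_circle p"] eq
      by (intro rev_image_eqI[of "frac (rep_circle p)"]) (auto simp: fixed_points_def less_imp_le)
  qed
qed

text \<open>\<open>baby_Sard\<close> speaks of Euclidean vectors, hence the passage to
  \<open>real ^ 1\<close>. The critical values form a negligible set, which cannot contain an open
  interval.\<close>

lemma ex_regular_value:
  fixes F F' :: "real \<Rightarrow> real"
  assumes DERIV: "\<And>x. (F has_real_derivative F' x) (at x)" and "\<epsilon> > 0"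
  obtains c where "0 < c" "c < \<epsilon>" "\<And>z. F z = c \<Longrightarrow> F' z \<noteq> 0"
proof -
  define \<Phi> :: "real ^ 1 \<Rightarrow> real ^ 1" where "\<Phi> v = F (v $ 1) *\<^sub>R 1" for v
  define S where "S = {v :: real ^ 1. F' (v $ 1) = 0}"
  have "(\<Phi> has_derivative (\<lambda>h. 0)) (at v within S)" if "v \<in> S" for v
  proof -
    have "((\<lambda>v :: real ^ 1. F (v $ 1)) has_derivative (\<lambda>h. F' (v $ 1) * h $ 1)) (at v within S)"
      by (rule has_derivative_compose[OF _ DERIV[unfolded has_field_derivative_def]])
        (auto intro: bounded_linear.has_derivative[OF bounded_linear_vec_nth])
    from has_derivative_scaleR_left[OF this, of 1] show ?thesis
      using that by (simp add: \<Phi>_def[abs_def] S_def)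
  qed
  moreover have "rank (matrix (\<lambda>h :: real ^ 1. 0 :: real ^ 1)) < CARD(1)"
  proof -
    have "matrix (\<lambda>h :: real ^ 1. 0 :: real ^ 1) = 0" by (simp add: matrix_def vec_eq_iff)
    then show ?thesis by simp
  qed
  ultimately have "negligible (\<Phi> ` S)" by (intro baby_Sard[where f' = "\<lambda>v h. 0"]) auto
  moreover have "\<not> negligible {w :: real ^ 1. 0 < w $ 1 \<and> w $ 1 < \<epsilon>}"
  proof (rule open_not_negligible)
    show "open {w :: real ^ 1. 0 < w $ 1 \<and> w $ 1 < \<epsilon>}"
      by (intro open_Collect_conj open_Collect_less continuous_intros)
    have "(\<epsilon> / 2) *\<^sub>R 1 \<in> {w :: real ^ 1. 0 < w $ 1 \<and> w $ 1 < \<epsilon>}" using assms(2) by simp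
    then show "{w :: real ^ 1. 0 < w $ 1 \<and> w $ 1 < \<epsilon>} \<noteq> {}" by blast
  qed
  ultimately have "\<not> {w :: real ^ 1. 0 < w $ 1 \<and> w $ 1 < \<epsilon>} \<subseteq> \<Phi> ` S"
    using negligible_subset[of "\<Phi> ` S"] by metis
  then obtain w :: "real ^ 1" where w: "0 < w $ 1" "w $ 1 < \<epsilon>" "w \<notin> \<Phi> ` S"
    by auto
  have "F' z \<noteq> 0" if "F z = w $ 1" for z
  proof
    assume "F' z = 0"
    then have "z *\<^sub>R 1 \<in> S" by (simp add: S_def)
    moreover have "\<Phi> (z *\<^sub>R 1) = w" using that by (simp add: \<Phi>_def vec_eq_iff)
    ultimately show False using w(3) by blast
  qed
  then show ?thesis using that w by blast
qed

text \<open>Subtracting a regular value \<open>c\<close> leaves the derivative unchanged, so the C1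
  distance is at most \<open>c\<close> and all zeros become simple.\<close>

lemma ex_near_finite_fixed_points:
  assumes f: "f \<in> C1_circle" and "\<epsilon> > 0"
  obtains g where "g \<in> C1_ball f \<epsilon>" "finite (fixed_points g)"
proof -
  interpret F: periodic_C1 "f \<circ> to_circle" "deriv (f \<circ> to_circle)" by (rule C1_circle_lift[OF f])
  obtain c where c: "0 < c" "c < \<epsilon>" "\<And>z. (f \<circ> to_circle) z = c \<Longrightarrow> deriv (f \<circ> to_circle) z \<noteq> 0"
    using ex_regular_value[OF F.DERIV assms(2)] by blast
  define G where "G x = (f \<circ> to_circle) x - c" for x
  have DG: "(G has_real_derivative deriv (f \<circ> to_circle) x) (at x)" for x
    unfolding G_def using DERIV_diff[OF F.DERIV DERIV_const] by simp
  interpret G: periodic_C1 G "deriv (f \<circ> to_circle)"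
    using DG F.continuous_deriv F.periodic by unfold_locales (simp_all add: G_def)
  obtain g where g: "g \<in> C1_circle" "g \<circ> to_circle = G"
    using periodic_C1_descend[OF G.periodic_C1_axioms] by blast
  have g': "g (to_circle x) = f (to_circle x) - c" for x using fun_cong[OF g(2), of x] by (simp add: G_def)
  have dg: "deriv (g \<circ> to_circle) x = deriv (f \<circ> to_circle) x" for x
    unfolding g(2) using DG by (rule DERIV_imp_deriv)
  have "g \<in> C1_ball f \<epsilon>"
    by (rule C1_ballI[OF f g(1), of c 0]) (use c in \<open>simp_all add: g' dg\<close>)
  moreover have "finite (fixed_points g)"
    by (rule finite_fixed_points[OF g(1)]) (use c(3) in \<open>simp add: g' dg\<close>)
  ultimately show ?thesis using that by blast
qed

text \<open>Squaring smooths the corner of \<open>max 0 u\<close>. The cut-off below is composed of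
  two such truncations.\<close>

lemma DERIV_max_square: "((\<lambda>u. (max 0 u)\<^sup>2) has_real_derivative 2 * max 0 u) (at u)"
proof -
  consider "u < 0" | "u = 0" | "u > 0" by linarith
  then show ?thesis
  proof cases
    case 1
    show ?thesis
      by (rule has_field_derivative_transform_within_open[of "\<lambda>u. 0" _ _ "{..<0}"]) (use 1 in auto)
  next
    case 2
    have "((\<lambda>h. (max 0 h)\<^sup>2 / h) \<longlongrightarrow> 0) (at (0::real))"
    proof (rule Lim_null_comparison)
      show "\<forall>\<^sub>F h in at 0. norm ((max 0 h)\<^sup>2 / h) \<le> \<bar>h :: real\<bar>"
        by (intro always_eventually) (auto simp: max_def power2_eq_square)
      show "((\<lambda>h. \<bar>h\<bar>) \<longlongrightarrow> 0) (at (0::real))"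
        using tendsto_rabs[OF tendsto_ident_at, of 0 UNIV] by simp
    qed
    then show ?thesis using 2 by (simp add: has_field_derivative_iff)
  next
    case 3
    have "((\<lambda>u. u\<^sup>2) has_real_derivative 2 * max 0 u) (at u)"
      using 3 by (auto intro!: derivative_eq_intros)
    then show ?thesis
      by (rule has_field_derivative_transform_within_open[of _ _ _ "{0<..}"]) (use 3 in auto)
  qed
qed

text \<open>Turns smallness of the sine into closeness to an integer. Up to \<open>1 / 6\<close> the
  cosine is at least \<open>1 / 2\<close> and \<open>pi \<ge> 2\<close>; beyond, the sine is at
  least \<open>sin (pi / 6) = 1 / 2\<close>.\<close>

lemma abs_le_abs_sin_pi:
  assumes "\<bar>y\<bar> \<le> 1 / 2"
  shows "\<bar>y\<bar> \<le> \<bar>sin (pi * y)\<bar>"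
proof -
  have pos: "t \<le> sin (pi * t)" if "0 \<le> t" "t \<le> 1 / 2" for t
  proof (cases "t \<le> 1 / 6")
    case True
    show ?thesis
    proof (cases "t = 0")
      case False
      then have "0 < pi * t" using that by simp
      then obtain \<xi> where \<xi>: "0 < \<xi>" "\<xi> < pi * t" "sin (pi * t) - sin 0 = (pi * t - 0) * cos \<xi>"
        using MVT2[of 0 "pi * t" sin cos] DERIV_sin by blast
      have "pi * t \<le> pi / 3" using True by simp
      then have "\<xi> \<le> pi / 3" using \<xi>(2) by linarith
      then have "cos (pi / 3) \<le> cos \<xi>" using \<xi>(1) by (intro cos_monotone_0_pi_le) auto
      then have "1 / 2 \<le> cos \<xi>" by (simp add: cos_60)
      then have "(2 * t) * (1 / 2) \<le> (pi * t) * cos \<xi>"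
        using that pi_ge_two by (intro mult_mono) auto
      then show ?thesis using \<xi>(3) by simp
    qed simp
  next
    case False
    have "sin (pi / 6) \<le> sin (pi * t)"
      using False that by (intro sin_monotone_2pi_le) (auto simp: field_simps)
    then show ?thesis using that by (simp add: sin_30)
  qed
  show ?thesis
  proof (cases "y \<ge> 0")
    case True
    then show ?thesis using pos[of y] assms by simp
  next
    case False
    then show ?thesis using pos[of "- y"] assms by simp
  qed
qed

text \<open>Where the cut-off \<open>\<beta>\<close> acts,
  \<open>\<bar>F\<bar> \<le> 2 * \<kappa> * \<delta>\<close> and
  \<open>\<bar>\<beta>'\<bar> \<le> 64 / \<delta>\<close>, so \<open>F * \<beta>'\<close> is at most
  \<open>128 * \<kappa>\<close> whatever \<open>\<delta>\<close> is. All errors add up to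
  \<open>131 * \<kappa>\<close>, below \<open>\<epsilon> = 200 * \<kappa>\<close>.\<close>

lemma ex_near_infinite_fixed_points:
  assumes f: "f \<in> C1_circle" and \<epsilon>: "\<epsilon> > 0"
    and x0: "f (to_circle x0) = 0" "deriv (f \<circ> to_circle) x0 = 0"
  obtains g where "g \<in> C1_ball f \<epsilon>" "infinite (fixed_points g)"
proof -
  define F where "F = f \<circ> to_circle"
  define F' where "F' = deriv F"
  interpret F: periodic_C1 F F' unfolding F'_def F_def by (rule C1_circle_lift[OF f])
  define \<kappa> where "\<kappa> = \<epsilon> / 200"
  have \<kappa>: "\<kappa> > 0" using \<epsilon> by (simp add: \<kappa>_def)
  have "isCont F' x0" using F.continuous_deriv continuous_on_eq_continuous_at by blast
  then obtain d where d: "d > 0" "\<And>x. \<bar>x - x0\<bar> < d \<Longrightarrow> \<bar>F' x\<bar> < \<kappa>"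
    using \<kappa> x0(2) unfolding continuous_at_eps_delta F'_def F_def
    by (metis dist_real_def diff_zero)
  define \<delta> where "\<delta> = min (d / 4) (1 / 4)"
  have \<delta>: "0 < \<delta>" "\<delta> \<le> 1" "2 * \<delta> < d" using d(1) by (auto simp: \<delta>_def)
  have \<delta>2: "2 * \<delta>\<^sup>2 \<le> (2 * \<delta>)\<^sup>2" by (simp add: power_mult_distrib)
  \<comment> \<open>\<open>\<beta>\<close> is a \<open>C\<^sup>1\<close> cut-off: it is \<open>0\<close> where \<open>s \<le> \<delta>\<^sup>2\<close> and \<open>1\<close> where \<open>s \<ge> 2 * \<delta>\<^sup>2\<close>.\<close>
  define m where "m u = (max 0 u)\<^sup>2" for u :: real
  \<comment> \<open>A smooth 1-periodic substitute for the squared distance to the lifts of the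
    degenerate point.\<close>
  define s where "s x = (sin (pi * (x - x0)))\<^sup>2" for x
  define v where "v x = 2 - s x / \<delta>\<^sup>2" for x
  define \<beta> where "\<beta> x = m (1 - m (v x))" for x
  define s' where "s' x = 2 * pi * sin (pi * (x - x0)) * cos (pi * (x - x0))" for x
  define \<beta>' where "\<beta>' x = 4 * max 0 (1 - m (v x)) * max 0 (v x) * (s' x / \<delta>\<^sup>2)" for x
  have D\<beta>: "(\<beta> has_real_derivative \<beta>' x) (at x)" for x
  proof -
    have "(s has_real_derivative s' x) (at x)"
      unfolding s_def s'_def by (auto intro!: derivative_eq_intros simp: algebra_simps)
    then have "(v has_real_derivative 0 - s' x / \<delta>\<^sup>2) (at x)"
      unfolding v_def by (intro DERIV_diff DERIV_const DERIV_cdivide)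
    then have "(v has_real_derivative - (s' x / \<delta>\<^sup>2)) (at x)" by simp
    note 1 = DERIV_chain2[OF DERIV_max_square this, folded m_def]
    have 2: "((\<lambda>x. 1 - m (v x)) has_real_derivative 0 - 2 * max 0 (v x) * - (s' x / \<delta>\<^sup>2)) (at x)"
      by (intro DERIV_diff DERIV_const 1)
    from DERIV_chain2[OF DERIV_max_square 2, folded m_def] show ?thesis
      unfolding \<beta>_def \<beta>'_def by (simp add: algebra_simps)
  qed
  have s_periodic: "s (x + 1) = s x" for x
  proof -
    have "pi * (x + 1 - x0) = pi * (x - x0) + pi" by (simp add: algebra_simps)
    then show ?thesis by (simp add: s_def)
  qed
  define G where "G x = F x * \<beta> x" for x
  define G' where "G' x = F' x * \<beta> x + F x * \<beta>' x" for x
  interpret G: periodic_C1 G G'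
  proof
    show "G (x + 1) = G x" for x
      by (simp add: G_def F.periodic \<beta>_def v_def s_periodic)
    show "(G has_real_derivative G' x) (at x)" for x
      unfolding G_def G'_def using DERIV_mult[OF F.DERIV[of x] D\<beta>[of x]] by (simp add: algebra_simps)
    have "continuous_on UNIV \<beta>" "continuous_on UNIV \<beta>'"
      unfolding \<beta>_def \<beta>'_def m_def v_def s_def s'_def by (intro continuous_intros; use \<delta>(1) in simp)+
    then show "continuous_on UNIV G'"
      unfolding G'_def by (intro continuous_intros F.continuous F.continuous_deriv)
  qed
  obtain g where g: "g \<in> C1_circle" "g \<circ> to_circle = G"
    using periodic_C1_descend[OF G.periodic_C1_axioms] by blast
  have small: "\<bar>F x\<bar> \<le> 2 * \<kappa> * \<delta> \<and> \<bar>F' x\<bar> \<le> \<kappa>" if "s x < 2 * \<delta>\<^sup>2" for x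
  proof -
    \<comment> \<open>An integer shift moves \<open>x\<close> to the translate \<open>x0 + y\<close>
      nearest \<open>x0\<close>. The small sine gives
      \<open>\<bar>y\<bar> \<le> 2 * \<delta>\<close>, and the mean value inequality from the zero
      \<open>x0\<close> bounds \<open>F\<close>.\<close>
    define n where "n = round (x - x0)"
    define y where "y = x - of_int n - x0"
    have "s x = (sin (pi * y))\<^sup>2"
      using periodic_Ints[of s "of_int n" "x0 + y", OF s_periodic] by (simp add: y_def s_def)
    then have "(sin (pi * y))\<^sup>2 < (2 * \<delta>)\<^sup>2" using that \<delta>2 by linarith
    then have "\<bar>sin (pi * y)\<bar> < 2 * \<delta>" using \<delta>(1) by (simp add: power2_less_imp_less[of "\<bar>sin (pi * y)\<bar>"])
    moreover have "\<bar>y\<bar> \<le> 1 / 2"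
      unfolding y_def n_def using of_int_round_abs_le[of "x - x0"] by (simp add: abs_minus_commute algebra_simps)
    ultimately have y: "\<bar>y\<bar> \<le> 2 * \<delta>" using abs_le_abs_sin_pi[of y] by simp
    have Fy: "F (x0 + y) = F x" "F' (x0 + y) = F' x"
      using periodic_Ints[of F "of_int n" "x0 + y", OF F.periodic]
        periodic_Ints[of F' "of_int n" "x0 + y", OF F.periodic_deriv]
      by (simp_all add: y_def)
    have "norm (F (x0 + y) - F x0) \<le> \<kappa> * norm (x0 + y - x0)"
    proof (rule field_differentiable_bound[of "cball x0 (2 * \<delta>)" F F'])
      fix z assume "z \<in> cball x0 (2 * \<delta>)"
      then have "\<bar>z - x0\<bar> < d" using \<delta>(3) by (simp add: dist_real_def abs_minus_commute)
      then show "norm (F' z) \<le> \<kappa>" using d(2)[of z] by simp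
      show "(F has_field_derivative F' z) (at z within cball x0 (2 * \<delta>))"
        using F.DERIV has_field_derivative_at_within by blast
    qed (use y \<delta>(1) in \<open>auto simp: dist_real_def\<close>)
    then have "\<bar>F x\<bar> \<le> \<kappa> * \<bar>y\<bar>" using x0(1) Fy(1) by (simp add: F_def)
    also have "\<dots> \<le> \<kappa> * (2 * \<delta>)" using y \<kappa> by (intro mult_left_mono) auto
    finally show ?thesis using d(2)[of "x0 + y"] y \<delta>(3) Fy(2) by (simp add: mult_ac)
  qed
  have m0: "m u \<ge> 0" for u by (simp add: m_def)
  have \<beta>01: "0 \<le> \<beta> x" "\<beta> x \<le> 1" for x
    using m0[of "v x"] by (auto simp: \<beta>_def m_def[of "1 - m (v x)"] power_le_one)
  have \<beta>'_le: "\<bar>\<beta>' x\<bar> \<le> 64 / \<delta>" if "s x < 2 * \<delta>\<^sup>2" for x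
  proof -
    \<comment> \<open>Both factors are at most 1 if \<open>v x \<le> 1\<close>; otherwise the first
      one vanishes.\<close>
    have 1: "max 0 (1 - m (v x)) * max 0 (v x) \<le> 1 * 1"
    proof (cases "v x \<le> 1")
      case True
      then show ?thesis using m0[of "v x"] by (intro mult_mono) auto
    next
      case False
      then have "m (v x) \<ge> 1" by (simp add: m_def one_le_power)
      then show ?thesis by simp
    qed
    have "(sin (pi * (x - x0)))\<^sup>2 < (2 * \<delta>)\<^sup>2" using that \<delta>2 unfolding s_def by linarith
    then have sin: "\<bar>sin (pi * (x - x0))\<bar> \<le> 2 * \<delta>"
      using \<delta>(1) by (simp add: power2_le_imp_le[of "\<bar>sin (pi * (x - x0))\<bar>"])
    have "\<bar>s' x\<bar> \<le> 2 * 4 * (2 * \<delta>) * 1"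
      unfolding s'_def abs_mult using sin pi_less_4 \<delta>(1) by (intro mult_mono) auto
    then have 2: "\<bar>s' x\<bar> \<le> 16 * \<delta>" by simp
    have "\<bar>\<beta>' x\<bar> = 4 * (max 0 (1 - m (v x)) * max 0 (v x)) * (\<bar>s' x\<bar> / \<delta>\<^sup>2)"
      by (simp add: \<beta>'_def abs_mult)
    also have "\<dots> \<le> 4 * 1 * (16 * \<delta> / \<delta>\<^sup>2)"
      using 1 2 \<delta>(1) by (intro mult_mono divide_right_mono) auto
    finally show ?thesis using \<delta>(1) by (simp add: power2_eq_square)
  qed
  have close: "\<bar>G x - F x\<bar> \<le> 2 * \<kappa> \<and> \<bar>G' x - F' x\<bar> \<le> 129 * \<kappa>" for x
  proof (cases "s x < 2 * \<delta>\<^sup>2")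
    case True
    note small = small[OF True, THEN conjunct1] small[OF True, THEN conjunct2]
    have "2 * \<kappa> * \<delta> \<le> 2 * \<kappa> * 1" using \<kappa> \<delta> by (intro mult_left_mono) auto
    then have F1: "\<bar>F x\<bar> \<le> 2 * \<kappa>" using small(1) by simp
    have \<beta>1: "\<bar>\<beta> x - 1\<bar> \<le> 1" using \<beta>01[of x] by simp
    have "G x - F x = F x * (\<beta> x - 1)" by (simp add: G_def algebra_simps)
    then have 1: "\<bar>G x - F x\<bar> \<le> 2 * \<kappa> * 1"
      using F1 \<beta>1 \<kappa> by (simp only: abs_mult) (intro mult_mono, auto)
    have "G' x - F' x = F' x * (\<beta> x - 1) + F x * \<beta>' x" by (simp add: G'_def algebra_simps)
    then have "\<bar>G' x - F' x\<bar> \<le> \<bar>F' x\<bar> * \<bar>\<beta> x - 1\<bar> + \<bar>F x\<bar> * \<bar>\<beta>' x\<bar>"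
      by (metis abs_mult abs_triangle_ineq)
    also have "\<dots> \<le> \<kappa> * 1 + 2 * \<kappa> * \<delta> * (64 / \<delta>)"
      using small \<beta>1 \<beta>'_le[OF True] \<kappa> \<delta>(1) by (intro add_mono mult_mono) auto
    also have "\<dots> = 129 * \<kappa>" using \<delta>(1) by simp
    finally show ?thesis using 1 by simp
  next
    case False
    then have "v x \<le> 0" using \<delta>(1) by (simp add: v_def field_simps)
    then have "m (v x) = 0" "max 0 (v x) = 0" by (simp_all add: m_def)
    then have "\<beta> x = 1" "\<beta>' x = 0" by (simp_all add: \<beta>_def \<beta>'_def m_def[of 1])
    then show ?thesis using \<kappa> by (simp add: G_def G'_def)
  qed
  have dG: "deriv (g \<circ> to_circle) x = G' x" for x unfolding g(2) using G.DERIV by (rule DERIV_imp_deriv)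
  have g_lift: "g (to_circle x) = G x" for x using fun_cong[OF g(2), of x] by simp
  have "g \<in> C1_ball f \<epsilon>"
  proof (rule C1_ballI[OF f g(1)])
    show "2 * \<kappa> + 129 * \<kappa> < \<epsilon>" using \<epsilon> by (simp add: \<kappa>_def)
    show "\<bar>g (to_circle x) - f (to_circle x)\<bar> \<le> 2 * \<kappa>" for x
      using close[of x] by (simp add: g_lift F_def)
    show "\<bar>deriv (g \<circ> to_circle) x - deriv (f \<circ> to_circle) x\<bar> \<le> 129 * \<kappa>" for x
      using close[of x] by (simp add: dG F'_def F_def)
  qed
  moreover have "infinite (fixed_points g)"
  proof
    assume fin: "finite (fixed_points g)"
    \<comment> \<open>As \<open>pi < 4\<close>, this arc lies where
      \<open>s x \<le> \<delta>\<^sup>2\<close>, so \<open>\<beta>\<close> vanishes on it.\<close>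
    have "to_circle ` {x0..x0 + \<delta> / 4} \<subseteq> fixed_points g"
    proof
      fix p assume "p \<in> to_circle ` {x0..x0 + \<delta> / 4}"
      then obtain x where x: "p = to_circle x" "0 \<le> x - x0" "x - x0 \<le> \<delta> / 4" by auto
      have "\<bar>sin (pi * (x - x0))\<bar> \<le> \<bar>pi * (x - x0)\<bar>" by (rule abs_sin_x_le_abs_x)
      also have "\<dots> \<le> 4 * (\<delta> / 4)"
        unfolding abs_mult using x pi_less_4 \<delta>(1) by (intro mult_mono) auto
      finally have "s x \<le> \<delta>\<^sup>2" unfolding s_def using \<delta>(1) by (simp add: power2_le_iff_abs_le)
      then have "v x \<ge> 1" using \<delta>(1) by (simp add: v_def field_simps)
      then have "m (v x) \<ge> 1" by (simp add: m_def one_le_power)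
      then have "\<beta> x = 0" by (simp add: \<beta>_def m_def[of "1 - m (v x)"])
      then show "p \<in> fixed_points g" by (simp add: fixed_points_def x(1) g_lift G_def)
    qed
    then have "finite (to_circle ` {x0..x0 + \<delta> / 4})" using fin finite_subset by blast
    moreover have "inj_on to_circle {x0..x0 + \<delta> / 4}"
    proof (rule inj_onI)
      fix x y assume "x \<in> {x0..x0 + \<delta> / 4}" "y \<in> {x0..x0 + \<delta> / 4}" "to_circle x = to_circle y"
      then have "x - y \<in> \<int>" "\<bar>x - y\<bar> < 1" using \<delta> by (auto simp: to_circle_eq_iff)
      then show "x = y" using Ints_nonzero_abs_less1 by fastforce
    qed
    ultimately have "finite {x0..x0 + \<delta> / 4}" by (rule finite_imageD)
    then show False using infinite_Icc[of x0 "x0 + \<delta> / 4"] \<delta>(1) by simp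
  qed
  ultimately show ?thesis using that by blast
qed

theorem theorem1:
  fixes f :: "circle \<Rightarrow> real"
  assumes "f \<in> C1_circle"
  shows "C1_structurally_stable f \<longleftrightarrow>
    finite (fixed_points f) \<and> (\<forall>p \<in> fixed_points f. hyperbolic f p)"
proof
  assume "C1_structurally_stable f"
  then obtain \<epsilon> where \<epsilon>: "\<epsilon> > 0" "\<And>g. g \<in> C1_ball f \<epsilon> \<Longrightarrow> topologically_equivalent f g"
    unfolding structurally_stable_iff by blast
  have finite_iff: "finite (fixed_points f) \<longleftrightarrow> finite (fixed_points g)" if g: "g \<in> C1_ball f \<epsilon>" for g
  proof -
    obtain h where h: "bij h" "h ` fixed_points f = fixed_points g"
      using equivalent_fixed_points[OF assms C1_ballD(1)[OF assms g] \<epsilon>(2)[OF g]] by blast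
    have "inj_on h (fixed_points f)" using h(1) by (meson bij_is_inj inj_on_subset subset_UNIV)
    then show ?thesis using finite_image_iff h(2) by metis
  qed
  \<comment> \<open>Finiteness comes first, since hyperbolicity is derived by contradicting
    it.\<close>
  have fin: "finite (fixed_points f)"
    using ex_near_finite_fixed_points[OF assms \<epsilon>(1)] finite_iff by metis
  moreover have "hyperbolic f p" if p: "p \<in> fixed_points f" for p
  proof (rule ccontr)
    assume "\<not> hyperbolic f p"
    then have "f (to_circle (rep_circle p)) = 0" "deriv (f \<circ> to_circle) (rep_circle p) = 0"
      using p by (simp_all add: fixed_points_def hyperbolic_def circle_deriv_def)
    then show False
      using ex_near_infinite_fixed_points[OF assms \<epsilon>(1)] finite_iff fin by metis
  qed
  ultimately show "finite (fixed_points f) \<and> (\<forall>p \<in> fixed_points f. hyperbolic f p)" by blast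
next
  assume "finite (fixed_points f) \<and> (\<forall>p \<in> fixed_points f. hyperbolic f p)"
  then show "C1_structurally_stable f" using hyperbolic_imp_stable[OF assms] by blast
qed

end
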